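(* Let $s\ge1$, $r=s+1$, $\rho>0$, $\alpha>0$, $h>0$, let $L:\mathbb R^d\times\mathbb R^d\to\mathbb R$ be a $C^2$ Lagrangian, and let $\mathbf b=(b_1,\ldots,b_{s+1})^\top$ be the weights of the $(s+1)$-stage Lobatto IIIC method, $\mathbf B=\mathrm{diag}(\mathbf b)$. Let $x_d=\{\mathbf x_k\}_{k=0}^N$, $y_d=\{\mathbf y_k\}_{k=0}^N$, $\mathbf x_k=(x_k^1,\ldots,x_k^{s+1})^\top$, $\mathbf y_k=(y_k^1,\ldots,y_k^{s+1})^\top$ with $x_k^i,y_k^i\in\mathbb R^d$, be discrete series such that $x_{k-1}^{s+1}=x_k^1$, $y_{k-1}^{s+1}=y_k^1$ for $k=1,\ldots,N$, and $x_N^i=y_N^i=0$ for $i=2,\ldots,s+1$. Then the equations $$D_{s+1}L_d(x_{k-1}^1,\ldots,x_{k-1}^{s+1})+D_1L_d(x_k^1,\ldots,x_k^{s+1})-\rho h\Big(b_1\big[\mathcal D_-^{(2\alpha)}\mathbf x_k\big]^1+b_{s+1}\big[\mathcal D_-^{(2\alpha)}\mathbf x_{k-1}\big]^{s+1}\Big)=0,\quad k=1,\ldots,N-1,$$ $$D_iL_d(x_k^1,\ldots,x_k^{s+1})-\rho h\,b_i\big[\mathcal D_-^{(2\alpha)}\mathbf x_k\big]^i=0,\quad k=0,\ldots,N-1,\ i=2,\ldots,s,$$ $$D_{s+1}L_d(y_{k-1}^1,\ldots,y_{k-1}^{s+1})+D_1L_d(y_k^1,\ldots,y_k^{s+1})-\rho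 h\Big(\big[\mathcal D_+^{(2\alpha)}\mathbf B\mathbf y_k\big]^1+\big[\mathcal D_+^{(2\alpha)}\mathbf B\mathbf y_{k-1}\big]^{s+1}\Big)=0,\quad k=1,\ldots,N-1,$$ $$D_iL_d(y_k^1,\ldots,y_k^{s+1})-\rho h\big[\mathcal D_+^{(2\alpha)}\mathbf B\mathbf y_k\big]^i=0,\quad k=0,\ldots,N-1,\ i=2,\ldots,s,$$ are a sufficient condition for $(x_d,y_d)$ to be an extremal, under restricted variations, of the discrete action $$\mathcal L_d(x_d,y_d)=\sum_{k=0}^{N-1}\big[L_d(x_k^1,\ldots,x_k^{s+1})+L_d(y_k^1,\ldots,y_k^{s+1})\big]-\rho h\sum_{k=0}^{N}\big\langle\mathcal D_+^{\alpha}\mathbf B\mathbf y_k,\ \mathcal D_-^{\alpha}\mathbf x_k\big\rangle .$$ That is, if these equations hold then $\frac{\mathrm d}{\mathrm d\epsilon}\big|_{\epsilon=0}\mathcal L_d(x_d^\epsilon,y_d^\epsilon)=0$ for all restricted varied curves $x_d^\epsilon=\{\mathbf x_k+\epsilon\,\delta\mathbf x_k\}_{k=0}^N$, $y_d^\epsilon=\{\mathbf y_k+\epsilon\,\delta\mathbf x_k\}_{k=0}^N$ (the same variation in $x$ and $y$) with $\delta\mathbf x_k=(\delta x_k^1,\ldots,\delta x_k^{s+1})^\top$, $\delta x_k^i\in\mathbb R^d$, satisfying $\delta x_{k-1}^{s+1}=\delta x_k^1$ for $k=1,\ldots,N$, $\delta x_0^1=0$ and $\delta\mathbf x_N=0$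 (hence $\delta x_{N-1}^{s+1}=0$).
   Context: Lobatto IIIC: for $r=s+1\ge2$ the abscissae $0=c_1<\cdots<c_r=1$ are the zeros of $\frac{\mathrm d^{r-2}}{\mathrm dx^{r-2}}\big(x^{r-1}(x-1)^{r-1}\big)$, $\mathbf b$ are the corresponding Lobatto quadrature weights on $[0,1]$, and $A=(a_{ij})\in\mathbb R^{r\times r}$ is determined by $a_{i1}=b_1$ for all $i$ and $\sum_j a_{ij}c_j^{q-1}=c_i^q/q$ for $q=1,\ldots,r-1$ and all $i$. ($A$ is invertible and its eigenvalues have positive real part.) Discrete Lagrangian: fix control points $0=d_0<d_1<\cdots<d_s=1$ and let $\ell_0,\ldots,\ell_s$ be the Lagrange polynomials of degree $s$ with $\ell_\nu(d_i)=\delta_{\nu i}$. For each $k$ let $x_d(t;k)=\sum_{\nu=0}^{s}x_k^{\nu+1}\,\ell_\nu(t/h)$, $t\in[0,h]$, and $$L_d(x_k^1,\ldots,x_k^{s+1})=h\sum_{i=1}^{r}b_i\,L\big(x_d(c_ih;k),\dot x_d(c_ih;k)\big),$$ and likewise for $y$. $D_iL_d$ denotes the partial derivative (gradient in $\mathbb R^d$) of $L_d$ with respect to its $i$-th argument. Runge-Kutta convolution quadrature for fractional derivatives: with $\mathds 1=(1,\ldots,1)^\top\in\mathbb R^r$ set $\gamma(z)=A^{-1}-z\,A^{-1}\mathds 1\,\mathbf b^\top A^{-1}$. For $\beta>0$ the weights $W_n^{(\beta)}\in\mathbb R^{r\times r}$ are the coefficients of the power series at $z=0$ $$\Big(\frac{\gamma(z)}{h}\Big)^{\beta}=\sum_{n=0}^\infty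 W_n^{(\beta)}z^n$$ (principal branch, holomorphic functional calculus). For a sequence $\{\mathbf f_k\}_{k=0}^N$ with $\mathbf f_k=(f_k^1,\ldots,f_k^r)^\top$, $f_k^i\in\mathbb R^d$ (matrices act on the stage index), $$\mathcal D_-^{\beta}\mathbf f_k=\sum_{n=0}^{k}W_n^{(\beta)}\mathbf f_{k-n},\qquad \mathcal D_+^{\beta}\mathbf f_k=\sum_{n=0}^{N-k}\big[W_n^{(\beta)}\big]^\top\mathbf f_{k+n},\qquad k=0,\ldots,N.$$ $\mathcal D_\pm^{(2\alpha)}$ is the operator with $\beta=2\alpha$; $\mathcal D_+^{\beta}\mathbf B\mathbf y_k$ is $\mathcal D_+^{\beta}$ applied to the sequence $\{\mathbf B\mathbf y_k\}$; $[\mathbf v]^i$ denotes the $i$-th row (stage component, in $\mathbb R^d$) of $\mathbf v$. $\langle\cdot,\cdot\rangle$ is the Euclidean inner product, summing over stages (and over the components in $\mathbb R^d$). *)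

theory Defs
  imports "HOL-Complex_Analysis.Complex_Analysis" "Jordan_Normal_Form.Spectral_Radius"
begin

text \<open>
  Stage indices are zero-based: stage \<open>i \<in> {0..s}\<close> below is stage \<open>i + 1\<close> of an
  \<open>(s + 1)\<close>-stage method.  A stage vector is a function on \<open>nat\<close> of which only the
  arguments \<open>0, \<dots>, s\<close> are used; a series of stage vectors is a function
  \<open>k \<mapsto> i \<mapsto> x k i\<close>.
\<close>

type_synonym 'a stages = "nat \<Rightarrow> 'a"
type_synonym 'a series = "nat \<Rightarrow> 'a stages"


subsection \<open>Lagrange polynomials and the Lobatto IIIC method\<close>

definition lagrange_poly :: "nat \<Rightarrow> (nat \<Rightarrow> real) \<Rightarrow> nat \<Rightarrow> real poly" where
  "lagrange_poly s d \<nu> = (\<Prod>j\<in>{0..s} - {\<nu>}. Polynomial.smult (1 / (d \<nu> - d j)) [:- d j, 1:])"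

lemma degree_lagrange_poly:
  assumes "inj_on d {0..s}" "\<nu> \<le> s"
  shows "degree (lagrange_poly s d \<nu>) = s"
proof -
  have nz: "d \<nu> - d j \<noteq> 0" if "j \<in> {0..s} - {\<nu>}" for j
    using assms that by (auto dest: inj_onD)
  have "degree (lagrange_poly s d \<nu>)
      = (\<Sum>j\<in>{0..s} - {\<nu>}. degree (Polynomial.smult (1 / (d \<nu> - d j)) [:- d j, 1:]))"
    unfolding lagrange_poly_def using nz by (subst degree_prod_eq_sum_degree) auto
  also have "\<dots> = (\<Sum>j\<in>{0..s} - {\<nu>}. 1)"
    using nz by (intro sum.cong) auto
  also have "\<dots> = s"
    using assms(2) by simp
  finally show ?thesis .
qed

lemma poly_lagrange_poly_node:
  assumes "inj_on d {0..s}" "\<nu> \<le> s" "i \<le> s"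
  shows "poly (lagrange_poly s d \<nu>) (d i) = (if i = \<nu> then 1 else 0)"
proof -
  have nz: "d \<nu> - d j \<noteq> 0" if "j \<in> {0..s} - {\<nu>}" for j
    using assms that by (auto dest: inj_onD)
  have eq: "poly (lagrange_poly s d \<nu>) t = (\<Prod>j\<in>{0..s} - {\<nu>}. (t - d j) / (d \<nu> - d j))" for t
    unfolding lagrange_poly_def poly_prod by (intro prod.cong) (auto simp: diff_divide_distrib)
  show ?thesis
  proof (cases "i = \<nu>")
    case True
    then show ?thesis
      unfolding eq using nz by (auto intro!: prod.neutral)
  next
    case False
    then show ?thesis
      unfolding eq using assms(3) by (auto intro!: prod_zero bexI[of _ i])
  qed
qed

definition lobatto_poly :: "nat \<Rightarrow> real poly" where
  "lobatto_poly r = (pderiv ^^ (r - 2)) ([:0, 1:] ^ (r - 1) * [:- 1, 1:] ^ (r - 1))"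

definition lobatto_nodes :: "nat \<Rightarrow> (nat \<Rightarrow> real) \<Rightarrow> bool" where
  "lobatto_nodes s c \<longleftrightarrow>
     strict_mono_on {0..s} c \<and> c 0 = 0 \<and> c s = 1 \<and>
     c ` {0..s} = {x. poly (lobatto_poly (s + 1)) x = 0}"

text \<open>Lobatto quadrature is interpolatory, so its weights are the integrals of the Lagrange
  polynomials of its nodes.\<close>

definition lobatto_weights :: "nat \<Rightarrow> (nat \<Rightarrow> real) \<Rightarrow> (nat \<Rightarrow> real) \<Rightarrow> bool" where
  "lobatto_weights s c b \<longleftrightarrow>
     (\<forall>i\<le>s. b i = integral {0..1} (poly (lagrange_poly s c i)))"

definition lobatto_IIIC ::
  "nat \<Rightarrow> (nat \<Rightarrow> real) \<Rightarrow> (nat \<Rightarrow> real) \<Rightarrow> real mat \<Rightarrow> bool" where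
  "lobatto_IIIC s c b A \<longleftrightarrow>
     lobatto_nodes s c \<and> lobatto_weights s c b \<and>
     A \<in> carrier_mat (s + 1) (s + 1) \<and>
     (\<forall>i\<le>s. A $$ (i, 0) = b 0) \<and>
     (\<forall>q\<in>{1..s}. \<forall>i\<le>s. (\<Sum>j=0..s. A $$ (i, j) * c j ^ (q - 1)) = c i ^ q / real q)"


subsection \<open>Holomorphic functional calculus and convolution quadrature weights\<close>

abbreviation mat_inv :: "'a::field mat \<Rightarrow> 'a mat" where
  "mat_inv M \<equiv> the (mat_inverse M)"

text \<open>
  \<open>has_holo_calc f U M P\<close> says that \<open>P = f(M)\<close> in the sense of the Riesz-Dunford integral, for
  \<open>f\<close> holomorphic on the open set \<open>U\<close>: the contour runs in \<open>U\<close>, winds once around every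
  eigenvalue of \<open>M\<close> and not around any point outside \<open>U\<close>.  By Cauchy's theorem \<open>P\<close> does not
  depend on the contour.
\<close>

definition has_holo_calc ::
  "(complex \<Rightarrow> complex) \<Rightarrow> complex set \<Rightarrow> complex mat \<Rightarrow> complex mat \<Rightarrow> bool" where
  "has_holo_calc f U M P \<longleftrightarrow>
     M \<in> carrier_mat (dim_row M) (dim_row M) \<and>
     (\<exists>\<Gamma>. valid_path \<Gamma> \<and> pathfinish \<Gamma> = pathstart \<Gamma> \<and>
        path_image \<Gamma> \<subseteq> U - spectrum M \<and>
        (\<forall>w\<in>spectrum M. winding_number \<Gamma> w = 1) \<and>
        (\<forall>w. w \<notin> U \<longrightarrow> winding_number \<Gamma> w = 0) \<and>
        P = mat (dim_row M) (dim_row M) (\<lambda>(i, j).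
              1 / (2 * complex_of_real pi * \<i>) *
              contour_integral \<Gamma>
                (\<lambda>w. f w * mat_inv (w \<cdot>\<^sub>m 1\<^sub>m (dim_row M) - M) $$ (i, j))))"

definition has_mat_powr :: "complex mat \<Rightarrow> real \<Rightarrow> complex mat \<Rightarrow> bool" where
  "has_mat_powr M \<beta> P \<longleftrightarrow>
     has_holo_calc (\<lambda>w. w powr complex_of_real \<beta>) (- \<real>\<^sub>\<le>\<^sub>0) M P"

definition rk_symbol :: "nat \<Rightarrow> real mat \<Rightarrow> (nat \<Rightarrow> real) \<Rightarrow> complex \<Rightarrow> complex mat" where
  "rk_symbol s A b z =
     (let A' = mat_inv (map_mat complex_of_real A);
          one = mat (s + 1) 1 (\<lambda>_. 1);
          bT = mat 1 (s + 1) (\<lambda>(_, j). complex_of_real (b j))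
      in A' - z \<cdot>\<^sub>m (A' * one * bT * A'))"

definition cq_weights ::
  "nat \<Rightarrow> real mat \<Rightarrow> (nat \<Rightarrow> real) \<Rightarrow> real \<Rightarrow> real \<Rightarrow> (nat \<Rightarrow> real mat) \<Rightarrow> bool" where
  "cq_weights s A b h \<beta> W \<longleftrightarrow>
     (\<forall>n. W n \<in> carrier_mat (s + 1) (s + 1)) \<and>
     (\<exists>R>0. \<forall>z. norm z < R \<longrightarrow>
        (\<exists>P. has_mat_powr (complex_of_real (1 / h) \<cdot>\<^sub>m rk_symbol s A b z) \<beta> P \<and>
             (\<forall>i\<le>s. \<forall>j\<le>s.
                (\<lambda>n. complex_of_real (W n $$ (i, j)) * z ^ n) sums (P $$ (i, j)))))"

definition cq_minus ::
  "nat \<Rightarrow> (nat \<Rightarrow> real mat) \<Rightarrow> ('a::real_vector) series \<Rightarrow> 'a series" where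
  "cq_minus s W f k i = (\<Sum>n=0..k. \<Sum>j=0..s. (W n $$ (i, j)) *\<^sub>R f (k - n) j)"

definition cq_plus ::
  "nat \<Rightarrow> nat \<Rightarrow> (nat \<Rightarrow> real mat) \<Rightarrow> ('a::real_vector) series \<Rightarrow> 'a series" where
  "cq_plus s N W f k i =
     (\<Sum>n=0..N - k. \<Sum>j=0..s. (transpose_mat (W n) $$ (i, j)) *\<^sub>R f (k + n) j)"

definition weighted :: "(nat \<Rightarrow> real) \<Rightarrow> ('a::real_vector) series \<Rightarrow> 'a series" where
  "weighted b y k i = b i *\<^sub>R y k i"


subsection \<open>The discrete Lagrangian and the discrete action\<close>

definition C2 :: "('a::real_normed_vector \<Rightarrow> real) \<Rightarrow> bool" where
  "C2 f \<longleftrightarrow>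
     (\<exists>(f' :: 'a \<Rightarrow> 'a \<Rightarrow>\<^sub>L real) (f'' :: 'a \<Rightarrow> 'a \<Rightarrow>\<^sub>L ('a \<Rightarrow>\<^sub>L real)).
        (\<forall>p. (f has_derivative blinfun_apply (f' p)) (at p)) \<and>
        (\<forall>p. (f' has_derivative blinfun_apply (f'' p)) (at p)) \<and>
        continuous_on UNIV f'')"

definition interp ::
  "nat \<Rightarrow> (nat \<Rightarrow> real) \<Rightarrow> real \<Rightarrow> ('a::real_vector) stages \<Rightarrow> real \<Rightarrow> 'a" where
  "interp s d h X t = (\<Sum>\<nu>=0..s. poly (lagrange_poly s d \<nu>) (t / h) *\<^sub>R X \<nu>)"

definition discrete_lagrangian ::
  "nat \<Rightarrow> (nat \<Rightarrow> real) \<Rightarrow> (nat \<Rightarrow> real) \<Rightarrow> (nat \<Rightarrow> real) \<Rightarrow> real \<Rightarrow>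
   ((real ^ 'd) \<times> (real ^ 'd) \<Rightarrow> real) \<Rightarrow> (real ^ 'd) stages \<Rightarrow> real" where
  "discrete_lagrangian s c b d h L X =
     h * (\<Sum>i=0..s. b i *
            L (interp s d h X (c i * h), vector_derivative (interp s d h X) (at (c i * h))))"

definition partial_grad ::
  "('a::real_inner stages \<Rightarrow> real) \<Rightarrow> nat \<Rightarrow> 'a stages \<Rightarrow> 'a" where
  "partial_grad F i X = (THE g. GDERIV (\<lambda>v. F (X(i := v))) (X i) :> g)"

text \<open>\<open>W\<close> is meant to be the weight sequence for the order \<open>\<alpha>\<close>, and \<open>Ld\<close> the discrete
  Lagrangian.\<close>

definition discrete_action ::
  "nat \<Rightarrow> nat \<Rightarrow> (nat \<Rightarrow> real) \<Rightarrow> real \<Rightarrow> real \<Rightarrow> (nat \<Rightarrow> real mat) \<Rightarrow>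
   ('a::real_inner stages \<Rightarrow> real) \<Rightarrow> 'a series \<Rightarrow> 'a series \<Rightarrow> real" where
  "discrete_action s N b h \<rho> W Ld x y =
     (\<Sum>k<N. Ld (x k) + Ld (y k))
     - \<rho> * h * (\<Sum>k=0..N. \<Sum>i=0..s.
         inner (cq_plus s N W (weighted b y) k i) (cq_minus s W x k i))"

definition restricted_variation :: "nat \<Rightarrow> nat \<Rightarrow> ('a::real_vector) series \<Rightarrow> bool" where
  "restricted_variation s N \<delta> \<longleftrightarrow>
     (\<forall>k\<in>{1..N}. \<delta> (k - 1) s = \<delta> k 0) \<and> \<delta> 0 0 = 0 \<and> (\<forall>i\<le>s. \<delta> N i = 0)"

text \<open>The same variation is applied to both series.\<close>

definition restricted_extremal ::
  "nat \<Rightarrow> nat \<Rightarrow> (('a::real_vector) series \<Rightarrow> 'a series \<Rightarrow> real) \<Rightarrow> 'a series \<Rightarrow> 'a series \<Rightarrow> bool"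
where
  "restricted_extremal s N S x y \<longleftrightarrow>
     (\<forall>\<delta>. restricted_variation s N \<delta> \<longrightarrow>
        ((\<lambda>\<epsilon>. S (\<lambda>k i. x k i + \<epsilon> *\<^sub>R \<delta> k i) (\<lambda>k i. y k i + \<epsilon> *\<^sub>R \<delta> k i))
           has_real_derivative 0) (at 0))"

end

theory Submission
  imports Defs
begin

text \<open>
  The coupling term of the action pairs $\mathcal{D}_+^\alpha \mathbf{B} y$ with $\mathcal{D}_-^\alpha x$.
  Two properties of the difference operators turn it into a term in which only one of the two factors
  carries an operator, now of order $2\alpha$.  First, $\mathcal{D}_+^\beta$ is the adjoint of
  $\mathcal{D}_-^\beta$ (\<open>cq_plus_adjoint\<close>), a mere exchange of finite sums.  Second,
  $\mathcal{D}_-^\alpha \mathcal{D}_-^\alpha = \mathcal{D}_-^{2\alpha}$ (\<open>cq_minus_cq_minus\<close>), because the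
  weights of order $2\alpha$ are the convolution square of those of order $\alpha$
  (\<open>cq_weights_convolution\<close>).  The coupling term thus equals both
  $\langle \mathbf{B} y, \mathcal{D}_-^{2\alpha} x\rangle$ and
  $\langle \mathcal{D}_+^{2\alpha} \mathbf{B} y, x\rangle$.  When $x$ and $y$ are varied by the same $\delta$,
  its derivative is
  $\langle \mathbf{B}\,\mathcal{D}_-^{2\alpha} x + \mathcal{D}_+^{2\alpha} \mathbf{B} y, \delta\rangle$.
  Together with the chain rule for the discrete Lagrangian (\<open>discrete_lagrangian_variation\<close>), the
  variation of the action is the sum of two pairings of $\delta$ with residuals, one in $x$ and one in $y$.
  Each of them vanishes by the corresponding equations, since $\delta$ takes the same value at the two
  stages where consecutive steps meet and vanishes at both ends (\<open>restricted_summation_by_parts\<close>).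

  The analytic content is the convolution identity, that is,
  $M^{2\alpha} = M^\alpha M^\alpha$ for $M = \gamma(z)/h$ and powers given by Dunford integrals along
  possibly different contours (\<open>has_holo_calc_mult\<close>).  The proof is algebraic: for a list of eigenvalues
  $l_1, \dots, l_m$ of $M$ with $\prod_k (M - l_k) = 0$, Newton interpolation
  $f = f(l_1) + (w - l_1) f_1$, $f_1 = f_1(l_2) + (w - l_2) f_2, \dots$ reduces the Dunford integral of
  $f g$ to a fixed matrix times that of $g$.  The interpolation remainder contributes nothing because a
  factor $w - l$ in the integrand amounts to a factor $M - l$ in front of the integral, by Cauchy's theorem.
  The normalisation, that the constant function $1$ is sent to the identity matrix, comes from the
  corresponding expansion of the resolvent and from the winding numbers being $1$.

  For all this, $\gamma(z)$ has to be an $(s+1) \times (s+1)$ matrix, which means that the Lobatto IIIC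
  matrix has to be invertible (\<open>lobatto_IIIC_det_nonzero\<close>).  This follows from its defining equations
  once the first weight is known to be nonzero (\<open>lobatto_weight_0_nonzero\<close>).
\<close>


section \<open>Annihilating products of spectral shifts\<close>

text \<open>
  The product $(M - l_m) \cdots (M - l_1) X$, as an iterated left multiplication: the inductions below
  split off the factor that acts first.
\<close>
fun shift_apply :: "'a::comm_ring_1 mat \<Rightarrow> 'a list \<Rightarrow> 'a mat \<Rightarrow> 'a mat" where
  "shift_apply M [] X = X"
| "shift_apply M (l # ls) X = shift_apply M ls ((M - l \<cdot>\<^sub>m 1\<^sub>m (dim_row M)) * X)"

lemma shift_apply_append: "shift_apply M (ks @ ls) X = shift_apply M ls (shift_apply M ks X)"
  by (induction ks arbitrary: X) auto

lemma shift_apply_carrier: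
  assumes "M \<in> carrier_mat n n" "X \<in> carrier_mat n m"
  shows "shift_apply M ls X \<in> carrier_mat n m"
  using assms(2)
proof (induction ls arbitrary: X)
  case (Cons l ls)
  have "(M - l \<cdot>\<^sub>m 1\<^sub>m n) * X \<in> carrier_mat n m"
    using assms(1) Cons.prems by (intro mult_carrier_mat) auto
  from Cons.IH[OF this] show ?case using assms(1) by simp
qed simp

lemma shift_apply_similar:
  assumes c: "P \<in> carrier_mat n n" "Q \<in> carrier_mat n n" "B \<in> carrier_mat n n"
    and QP: "Q * P = 1\<^sub>m n" and PQ: "P * Q = 1\<^sub>m n" and X: "X \<in> carrier_mat n m"
  shows "shift_apply (P * B * Q) ls (P * X) = P * shift_apply B ls X"
  using X
proof (induction ls arbitrary: X)
  case (Cons l ls)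
  have eq: "P * B * Q - l \<cdot>\<^sub>m 1\<^sub>m n = P * (B - l \<cdot>\<^sub>m 1\<^sub>m n) * Q"
  proof -
    have l1: "l \<cdot>\<^sub>m 1\<^sub>m n \<in> carrier_mat n n" by simp
    have "P * (B - l \<cdot>\<^sub>m 1\<^sub>m n) * Q = (P * B - P * (l \<cdot>\<^sub>m 1\<^sub>m n)) * Q"
      by (simp only: mult_minus_distrib_mat[OF c(1,3) l1])
    also have "\<dots> = P * B * Q - P * (l \<cdot>\<^sub>m 1\<^sub>m n) * Q"
      by (rule minus_mult_distrib_mat[OF mult_carrier_mat[OF c(1,3)] mult_carrier_mat[OF c(1) l1] c(2)])
    also have "P * (l \<cdot>\<^sub>m 1\<^sub>m n) * Q = l \<cdot>\<^sub>m (P * 1\<^sub>m n * Q)"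
      by (simp only: mult_smult_distrib[OF c(1) one_carrier_mat]
          mult_smult_assoc_mat[OF mult_carrier_mat[OF c(1) one_carrier_mat] c(2)])
    also have "P * 1\<^sub>m n * Q = 1\<^sub>m n" using c PQ by simp
    finally show ?thesis by simp
  qed
  have "(P * B * Q - l \<cdot>\<^sub>m 1\<^sub>m n) * (P * X) = P * (B - l \<cdot>\<^sub>m 1\<^sub>m n) * (Q * (P * X))"
    unfolding eq using c Cons.prems by (intro assoc_mult_mat) auto
  also have "Q * (P * X) = X"
    using c Cons.prems QP by (simp flip: assoc_mult_mat)
  also have "P * (B - l \<cdot>\<^sub>m 1\<^sub>m n) * X = P * ((B - l \<cdot>\<^sub>m 1\<^sub>m n) * X)"
    using c Cons.prems by (intro assoc_mult_mat) auto
  finally have *: "(P * B * Q - l \<cdot>\<^sub>m 1\<^sub>m n) * (P * X) = P * ((B - l \<cdot>\<^sub>m 1\<^sub>m n) * X)" .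
  have "(B - l \<cdot>\<^sub>m 1\<^sub>m n) * X \<in> carrier_mat n m" using c Cons.prems by (intro mult_carrier_mat) auto
  from Cons.IH[OF this] show ?case using c * by simp
qed simp

text \<open>
  For an upper triangular matrix, subtracting the diagonal entry $B_{pp}$ and multiplying from the left
  turns a matrix whose rows below row $p$ vanish into one whose row $p$ vanishes as well.  The diagonal
  therefore has to be run through from the last entry to the first.
\<close>
lemma upper_triangular_shift_rows_0:
  assumes B: "B \<in> carrier_mat n n" "upper_triangular B" and X: "X \<in> carrier_mat n m" and "k \<le> n"
  shows "\<forall>i j. n - k \<le> i \<longrightarrow> i < n \<longrightarrow> j < m \<longrightarrow>
    shift_apply B (map (\<lambda>i. B $$ (n - 1 - i, n - 1 - i)) [0..<k]) X $$ (i, j) = 0"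
  using \<open>k \<le> n\<close>
proof (induction k)
  case (Suc k)
  define p where "p = n - 1 - k"
  define Y where "Y = shift_apply B (map (\<lambda>i. B $$ (n - 1 - i, n - 1 - i)) [0..<k]) X"
  define C where "C = B - B $$ (p, p) \<cdot>\<^sub>m 1\<^sub>m n"
  have Y: "Y \<in> carrier_mat n m" unfolding Y_def using B X by (intro shift_apply_carrier) auto
  have C: "C \<in> carrier_mat n n" unfolding C_def using B by auto
  have p: "p < n" "n - k = Suc p" "n - Suc k = p" using Suc.prems unfolding p_def by auto
  have Y0: "Y $$ (i, j) = 0" if "p < i" "i < n" "j < m" for i j
    using Suc.IH Suc.prems that p(2) unfolding Y_def by auto
  have C0: "C $$ (i, j) = 0" if "j < i \<or> (i = p \<and> j = p)" "i < n" for i j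
    using B that upper_triangularD[OF B(2), of j i] unfolding C_def by auto
  have "(C * Y) $$ (i, j) = 0" if "p \<le> i" "i < n" "j < m" for i j
  proof -
    have "(C * Y) $$ (i, j) = (\<Sum>q<n. C $$ (i, q) * Y $$ (q, j))"
      using that C Y by (simp add: scalar_prod_def lessThan_atLeast0)
    also have "\<dots> = 0"
    proof (rule sum.neutral, safe)
      fix q assume "q < n"
      have "q < i \<or> (i = p \<and> q = p) \<or> p < q" using that(1) by auto
      then show "C $$ (i, q) * Y $$ (q, j) = 0"
        using C0[of q i] Y0[of q j] \<open>q < n\<close> that by auto
    qed
    finally show ?thesis .
  qed
  moreover have "shift_apply B (map (\<lambda>i. B $$ (n - 1 - i, n - 1 - i)) [0..<Suc k]) X = C * Y"
    using B(1) unfolding C_def Y_def p_def by (auto simp: shift_apply_append)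
  ultimately show ?case using p(3) by simp
qed auto

text \<open>
  A form of the Cayley-Hamilton theorem, obtained by triangularising $M$: a product of shifts
  $M - \lambda$ by eigenvalues vanishes.  The inductions below on the resolvent and on Dunford
  integrals run along such a list of eigenvalues.
\<close>
lemma ex_annihilating_spectrum:
  fixes M :: "complex mat"
  assumes M: "M \<in> carrier_mat n n"
  shows "\<exists>ls. set ls \<subseteq> spectrum M \<and> (\<forall>X\<in>carrier_mat n n. shift_apply M ls X = 0\<^sub>m n n)"
proof -
  obtain es where es: "char_poly M = (\<Prod>a\<leftarrow>es. [:- a, 1:])"
    using char_poly_factorized[OF M] by auto
  obtain B where B: "B \<in> carrier_mat n n" "upper_triangular B" and sim: "similar_mat M B"
    using schur_decomposition_exists[OF M es] by auto
  obtain P Q where PQ: "P \<in> carrier_mat n n" "Q \<in> carrier_mat n n" "P * Q = 1\<^sub>m n" "Q * P = 1\<^sub>m n"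
    "M = P * B * Q"
    using similar_matD[OF sim] M by fastforce
  define ls where "ls = map (\<lambda>i. B $$ (n - 1 - i, n - 1 - i)) [0..<n]"
  have spec: "l \<in> spectrum M" if l: "l \<in> set ls" for l
  proof -
    have "l \<in> set (diag_mat B)" using l B unfolding ls_def diag_mat_def by auto
    then have "poly (\<Prod>a\<leftarrow>diag_mat B. [:- a, 1:]) l = 0"
      by (auto simp: poly_prod_list prod_list_zero_iff o_def)
    then have "poly (char_poly M) l = 0"
      unfolding char_poly_similar[OF sim] char_poly_upper_triangular[OF B] .
    then show ?thesis unfolding spectrum_def eigenvalue_root_char_poly[OF M, symmetric] by simp
  qed
  have "shift_apply M ls X = 0\<^sub>m n n" if X: "X \<in> carrier_mat n n" for X
  proof -
    have QX: "Q * X \<in> carrier_mat n n" using PQ X by auto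
    have "shift_apply B ls (Q * X) = 0\<^sub>m n n"
      using upper_triangular_shift_rows_0[OF B QX order.refl] shift_apply_carrier[OF B(1) QX, of ls]
      unfolding ls_def by (intro eq_matI) auto
    then have "shift_apply (P * B * Q) ls (P * (Q * X)) = P * 0\<^sub>m n n"
      using shift_apply_similar[OF PQ(1,2) B(1) PQ(4,3) QX] by simp
    moreover have "P * (Q * X) = X" using PQ X by (simp flip: assoc_mult_mat)
    ultimately show ?thesis using PQ by simp
  qed
  with spec show ?thesis by blast
qed


section \<open>The resolvent\<close>

abbreviation resolvent :: "complex mat \<Rightarrow> complex \<Rightarrow> complex mat" where
  "resolvent M w \<equiv> mat_inv (w \<cdot>\<^sub>m 1\<^sub>m (dim_row M) - M)"

lemma mat_inv_of_det:
  fixes A :: "'a::field mat"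
  assumes A: "A \<in> carrier_mat n n" and "Determinant.det A \<noteq> 0"
  shows "mat_inv A \<in> carrier_mat n n" "A * mat_inv A = 1\<^sub>m n" "mat_inv A * A = 1\<^sub>m n"
proof -
  have "mat_inverse A \<noteq> None"
    using mat_inverse(1)[OF A, of "()"] det_non_zero_imp_unit[OF assms, of "()"] by blast
  then obtain B where "mat_inverse A = Some B" by auto
  with mat_inverse(2)[OF A this]
  show "mat_inv A \<in> carrier_mat n n" "A * mat_inv A = 1\<^sub>m n" "mat_inv A * A = 1\<^sub>m n" by auto
qed

lemma resolvent_inverse:
  assumes M: "M \<in> carrier_mat n n" and w: "w \<notin> spectrum M"
  shows "resolvent M w \<in> carrier_mat n n"
    "(w \<cdot>\<^sub>m 1\<^sub>m n - M) * resolvent M w = 1\<^sub>m n" "resolvent M w * (w \<cdot>\<^sub>m 1\<^sub>m n - M) = 1\<^sub>m n"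
proof -
  have c: "w \<cdot>\<^sub>m 1\<^sub>m n - M \<in> carrier_mat n n" using M by auto
  have "char_matrix M w = (-1) \<cdot>\<^sub>m (w \<cdot>\<^sub>m 1\<^sub>m n - M)"
    unfolding char_matrix_def using M by (intro eq_matI) auto
  moreover have "Determinant.det (char_matrix M w) \<noteq> 0"
    using w eigenvalue_det[OF M] unfolding spectrum_def by auto
  ultimately have "Determinant.det (w \<cdot>\<^sub>m 1\<^sub>m n - M) \<noteq> 0" using c by (auto simp: det_smult)
  from mat_inv_of_det[OF c this] show
    "resolvent M w \<in> carrier_mat n n"
    "(w \<cdot>\<^sub>m 1\<^sub>m n - M) * resolvent M w = 1\<^sub>m n" "resolvent M w * (w \<cdot>\<^sub>m 1\<^sub>m n - M) = 1\<^sub>m n"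
    using M by auto
qed

lemma resolvent_shift_left:
  assumes M: "M \<in> carrier_mat n n" and w: "w \<notin> spectrum M"
  shows "(w - l) \<cdot>\<^sub>m resolvent M w = 1\<^sub>m n + (M - l \<cdot>\<^sub>m 1\<^sub>m n) * resolvent M w"
proof -
  note r = resolvent_inverse[OF M w]
  have "(w - l) \<cdot>\<^sub>m resolvent M w = ((w - l) \<cdot>\<^sub>m 1\<^sub>m n) * resolvent M w"
    unfolding mult_smult_assoc_mat[OF one_carrier_mat r(1)] left_mult_one_mat[OF r(1)] ..
  also have "(w - l) \<cdot>\<^sub>m 1\<^sub>m n = (w \<cdot>\<^sub>m 1\<^sub>m n - M) + (M - l \<cdot>\<^sub>m 1\<^sub>m n)"
    using M by (intro eq_matI) (auto simp: algebra_simps)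
  also have "\<dots> * resolvent M w = 1\<^sub>m n + (M - l \<cdot>\<^sub>m 1\<^sub>m n) * resolvent M w"
    using M r by (subst add_mult_distrib_mat[where nr = n and n = n and nc = n]) auto
  finally show ?thesis .
qed

lemma resolvent_shift_right:
  assumes M: "M \<in> carrier_mat n n" and w: "w \<notin> spectrum M" and X: "X \<in> carrier_mat n n"
  shows "(w - l) \<cdot>\<^sub>m (resolvent M w * X) = X + resolvent M w * ((M - l \<cdot>\<^sub>m 1\<^sub>m n) * X)"
proof -
  note r = resolvent_inverse[OF M w]
  have "(w - l) \<cdot>\<^sub>m (resolvent M w * X) = resolvent M w * (((w - l) \<cdot>\<^sub>m 1\<^sub>m n) * X)"
    unfolding mult_smult_assoc_mat[OF one_carrier_mat X] left_mult_one_mat[OF X]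
      mult_smult_distrib[OF r(1) X] ..
  also have "(w - l) \<cdot>\<^sub>m 1\<^sub>m n = (w \<cdot>\<^sub>m 1\<^sub>m n - M) + (M - l \<cdot>\<^sub>m 1\<^sub>m n)"
    using M by (intro eq_matI) (auto simp: algebra_simps)
  also have "((w \<cdot>\<^sub>m 1\<^sub>m n - M) + (M - l \<cdot>\<^sub>m 1\<^sub>m n)) * X
      = (w \<cdot>\<^sub>m 1\<^sub>m n - M) * X + (M - l \<cdot>\<^sub>m 1\<^sub>m n) * X"
    using M X by (intro add_mult_distrib_mat) auto
  also have "resolvent M w * \<dots> = resolvent M w * ((w \<cdot>\<^sub>m 1\<^sub>m n - M) * X)
      + resolvent M w * ((M - l \<cdot>\<^sub>m 1\<^sub>m n) * X)"
    using M X r by (intro mult_add_distrib_mat) auto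
  also have "resolvent M w * ((w \<cdot>\<^sub>m 1\<^sub>m n - M) * X) = X"
    using M X r by (subst assoc_mult_mat[symmetric, where ?n\<^sub>1 = n and ?n\<^sub>2 = n and ?n\<^sub>3 = n and ?n\<^sub>4 = n]) auto
  finally show ?thesis .
qed

text \<open>
  One step of the finite Newton expansion
  $(w - M)^{-1} X = \sum_k (w - l_1)^{-1} \cdots (w - l_{k+1})^{-1} (M - l_k) \cdots (M - l_1) X$.
  For an annihilating list of eigenvalues the recursion ends with $0$, so that the entries of the
  resolvent are rational functions with poles in the spectrum.
\<close>
lemma resolvent_entry_step:
  assumes M: "M \<in> carrier_mat n n" and w: "w \<notin> spectrum M" and l: "l \<in> spectrum M"
    and X: "X \<in> carrier_mat n n" and ij: "i < n" "j < n"
  shows "(resolvent M w * X) $$ (i, j) =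
    (X $$ (i, j) + (resolvent M w * ((M - l \<cdot>\<^sub>m 1\<^sub>m n) * X)) $$ (i, j)) / (w - l)"
proof -
  have c: "resolvent M w * X \<in> carrier_mat n n"
    "resolvent M w * ((M - l \<cdot>\<^sub>m 1\<^sub>m n) * X) \<in> carrier_mat n n"
    using resolvent_inverse(1)[OF M w] X M by (auto intro!: mult_carrier_mat)
  have "w \<noteq> l" using w l by auto
  have "(w - l) * (resolvent M w * X) $$ (i, j) = ((w - l) \<cdot>\<^sub>m (resolvent M w * X)) $$ (i, j)"
    using c(1) ij by (subst index_smult_mat) (auto simp del: index_mult_mat)
  also have "\<dots> = X $$ (i, j) + (resolvent M w * ((M - l \<cdot>\<^sub>m 1\<^sub>m n) * X)) $$ (i, j)"
    unfolding resolvent_shift_right[OF M w X]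
    using c(2) ij by (subst index_add_mat) (auto simp del: index_mult_mat)
  finally show ?thesis using \<open>w \<noteq> l\<close> by (simp add: field_simps)
qed

lemma finite_spectrum:
  fixes M :: "complex mat"
  assumes "M \<in> carrier_mat n n" shows "finite (spectrum M)"
  using card_finite_spectrum[OF assms] by auto

lemma resolvent_holomorphic:
  assumes M: "M \<in> carrier_mat n n" and ij: "i < n" "j < n"
  shows "(\<lambda>w. resolvent M w $$ (i, j)) holomorphic_on - spectrum M"
proof -
  obtain ls where ls: "set ls \<subseteq> spectrum M" "shift_apply M ls (1\<^sub>m n) = 0\<^sub>m n n"
    using ex_annihilating_spectrum[OF M] by (metis one_carrier_mat)
  have "(\<lambda>w. (resolvent M w * X) $$ (i, j)) holomorphic_on - spectrum M"
    if "X \<in> carrier_mat n n" "shift_apply M ls X = 0\<^sub>m n n" for X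
    using that ls(1)
  proof (induction ls arbitrary: X)
    case Nil
    have X0: "X = 0\<^sub>m n n" using Nil by simp
    have "(resolvent M w * X) $$ (i, j) = 0" if "w \<in> - spectrum M" for w
      unfolding X0 right_mult_zero_mat[OF resolvent_inverse(1)[OF M ComplD[OF that]]] using ij by simp
    then show ?case by (subst holomorphic_cong[OF refl, of _ _ "\<lambda>_. 0"]) auto
  next
    case (Cons l ls)
    have "(M - l \<cdot>\<^sub>m 1\<^sub>m n) * X \<in> carrier_mat n n" using M Cons.prems by (intro mult_carrier_mat) auto
    then have IH: "(\<lambda>w. (resolvent M w * ((M - l \<cdot>\<^sub>m 1\<^sub>m n) * X)) $$ (i, j))
        holomorphic_on - spectrum M"
      using Cons.prems M by (intro Cons.IH) auto
    have "(\<lambda>w. (X $$ (i, j) + (resolvent M w * ((M - l \<cdot>\<^sub>m 1\<^sub>m n) * X)) $$ (i, j)) / (w - l))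
        holomorphic_on - spectrum M"
      using Cons.prems(3) by (intro holomorphic_intros IH) auto
    then show ?case
    proof (rule holomorphic_transform)
      fix w assume "w \<in> - spectrum M"
      then show "(X $$ (i, j) + (resolvent M w * ((M - l \<cdot>\<^sub>m 1\<^sub>m n) * X)) $$ (i, j)) / (w - l)
          = (resolvent M w * X) $$ (i, j)"
        using Cons.prems(3) by (intro resolvent_entry_step[OF M _ _ Cons.prems(1) ij, symmetric]) auto
    qed
  qed
  from this[OF _ ls(2)] have "(\<lambda>w. (resolvent M w * 1\<^sub>m n) $$ (i, j)) holomorphic_on - spectrum M"
    by simp
  then show ?thesis
  proof (rule holomorphic_transform)
    fix w assume "w \<in> - spectrum M"
    then show "(resolvent M w * 1\<^sub>m n) $$ (i, j) = resolvent M w $$ (i, j)"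
      using right_mult_one_mat[OF resolvent_inverse(1)[OF M]] by simp
  qed
qed


section \<open>Dunford integrals along loops around the spectrum\<close>

text \<open>
  Only the simple quotient $1 / (w - l)$ contributes: with two distinct factors, partial fractions
  reduce the number of factors by one and the two contributions cancel (their winding numbers agree);
  with all factors equal and at least two of them, there is a primitive.
\<close>
lemma has_contour_integral_inverse_prod_loop:
  assumes v: "valid_path \<Gamma>" "pathfinish \<Gamma> = pathstart \<Gamma>"
    and ls: "\<And>l. l \<in> set ls \<Longrightarrow> l \<notin> path_image \<Gamma> \<and> winding_number \<Gamma> l = 1" and "ls \<noteq> []"
  shows "((\<lambda>w. 1 / (\<Prod>l\<leftarrow>ls. w - l)) has_contour_integral
            (if length ls = 1 then 2 * complex_of_real pi * \<i> else 0)) \<Gamma>"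
  using ls \<open>ls \<noteq> []\<close>
proof (induction "length ls" arbitrary: ls rule: less_induct)
  case less
  obtain a ks where ak: "ls = a # ks" using less.prems(2) by (cases ls) auto
  show ?case
  proof (cases "\<exists>b\<in>set ks. b \<noteq> a")
    case True
    then obtain b where b: "b \<in> set ks" "b \<noteq> a" by auto
    define ms where "ms = remove1 b ks"
    have len: "length ks = Suc (length ms)"
      using b length_pos_if_in_set[OF b(1)] unfolding ms_def by (simp add: length_remove1)
    have sub: "set ms \<subseteq> set ls" unfolding ms_def ak using set_remove1_subset by fastforce
    have pr: "(\<Prod>l\<leftarrow>ks. w - l) = (w - b) * (\<Prod>l\<leftarrow>ms. w - l)" for w
      unfolding ms_def by (rule prod_list_map_remove1[OF b(1)])
    have I: "((\<lambda>w. 1 / (\<Prod>l\<leftarrow>(c # ms). w - l)) has_contour_integral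
            (if length (c # ms) = 1 then 2 * complex_of_real pi * \<i> else 0)) \<Gamma>"
      if "c = a \<or> c = b" for c
      using less.prems(1) sub that b ak len by (intro less.hyps) auto
    have "((\<lambda>w. (1 / (\<Prod>l\<leftarrow>(a # ms). w - l) - 1 / (\<Prod>l\<leftarrow>(b # ms). w - l)) / (a - b))
        has_contour_integral 0) \<Gamma>"
      using has_contour_integral_div[OF has_contour_integral_diff[OF I[of a] I[of b]], of "a - b"]
      by simp
    then have "((\<lambda>w. 1 / (\<Prod>l\<leftarrow>ls. w - l)) has_contour_integral 0) \<Gamma>"
    proof (rule has_contour_integral_eq)
      fix w assume w: "w \<in> path_image \<Gamma>"
      then have ne: "w \<noteq> a" "w \<noteq> b" using less.prems(1) ak b by auto
      show "(1 / (\<Prod>l\<leftarrow>(a # ms). w - l) - 1 / (\<Prod>l\<leftarrow>(b # ms). w - l)) / (a - b)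
          = 1 / (\<Prod>l\<leftarrow>ls. w - l)"
      proof (cases "(\<Prod>l\<leftarrow>ms. w - l) = 0")
        case False
        have "(1 / (A * p) - 1 / (B * p)) / (B - A) = 1 / (A * (B * p))"
          if "A \<noteq> 0" "B \<noteq> 0" "p \<noteq> 0" "A \<noteq> B" for A B p :: complex
          using that by (simp add: divide_simps)
        from this[of "w - a" "w - b", OF _ _ False] show ?thesis
          using ne b(2) unfolding ak by (simp add: pr)
      next
        case True
        show ?thesis unfolding ak by (simp only: list.map prod_list.Cons pr True) simp
      qed
    qed
    then show ?thesis using len ak by simp
  next
    case False
    then have ks: "ks = replicate (length ks) a" by (metis replicate_length_same)
    have pr: "(\<Prod>l\<leftarrow>ls. w - l) = (w - a) ^ Suc (length ks)" for w
      unfolding ak by (subst ks) simp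
    have a: "a \<notin> path_image \<Gamma>" "winding_number \<Gamma> a = 1" using less.prems(1) ak by auto
    show ?thesis
    proof (cases "length ks = 0")
      case True
      then show ?thesis
        using has_contour_integral_winding_number[OF v(1) a(1)] a(2) ak by simp
    next
      case ne: False
      define m where "m = length ks"
      have "((\<lambda>w. 1 / (w - a) ^ Suc m) has_contour_integral
         (- (inverse (pathfinish \<Gamma> - a) ^ m) / of_nat m) - (- (inverse (pathstart \<Gamma> - a) ^ m) / of_nat m)) \<Gamma>"
      proof (rule contour_integral_primitive[of "path_image \<Gamma>"])
        fix w assume "w \<in> path_image \<Gamma>"
        then have "w \<noteq> a" using a by auto
        moreover obtain p where p: "m = Suc p" using ne unfolding m_def by (cases "length ks") auto
        ultimately have "((\<lambda>w. inverse (w - a)) has_field_derivative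
            - (inverse (w - a) * inverse (w - a))) (at w within path_image \<Gamma>)"
          by (auto intro!: derivative_eq_intros)
        from DERIV_cdivide[OF DERIV_minus[OF DERIV_power[OF this, of m]], of "of_nat m"]
        have "((\<lambda>w. - (inverse (w - a) ^ m) / of_nat m) has_field_derivative
            - (of_nat m * (- (inverse (w - a) * inverse (w - a)) * inverse (w - a) ^ (m - Suc 0)))
              / of_nat m) (at w within path_image \<Gamma>)" .
        also have "- (of_nat m * (- (inverse (w - a) * inverse (w - a)) * inverse (w - a) ^ (m - Suc 0)))
              / of_nat m = 1 / (w - a) ^ Suc m"
          unfolding p by (simp add: inverse_eq_divide power_divide del: of_nat_Suc)
        finally show "((\<lambda>w. - (inverse (w - a) ^ m) / of_nat m) has_field_derivative
            1 / (w - a) ^ Suc m) (at w within path_image \<Gamma>)" .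
      qed (use v in auto)
      moreover have "length ls \<noteq> 1" using ne ak by simp
      ultimately show ?thesis using v(2) unfolding pr m_def by simp
    qed
  qed
qed

text \<open>
  The contours that \<^const>\<open>has_holo_calc\<close> admits.
\<close>
locale spectral_loop =
  fixes \<Gamma> :: "real \<Rightarrow> complex" and U :: "complex set" and M :: "complex mat" and n :: nat
  assumes M: "M \<in> carrier_mat n n"
    and valid: "valid_path \<Gamma>" and loop: "pathfinish \<Gamma> = pathstart \<Gamma>"
    and image: "path_image \<Gamma> \<subseteq> U - spectrum M"
    and wn_in: "\<And>w. w \<in> spectrum M \<Longrightarrow> winding_number \<Gamma> w = 1"
    and wn_out: "\<And>w. w \<notin> U \<Longrightarrow> winding_number \<Gamma> w = 0"

definition dunford_integral ::
  "(real \<Rightarrow> complex) \<Rightarrow> complex mat \<Rightarrow> (complex \<Rightarrow> complex) \<Rightarrow> complex mat" where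
  "dunford_integral \<Gamma> M f = mat (dim_row M) (dim_row M) (\<lambda>(i, j).
     1 / (2 * complex_of_real pi * \<i>) * contour_integral \<Gamma> (\<lambda>w. f w * resolvent M w $$ (i, j)))"

lemma has_holo_calc_iff:
  assumes "M \<in> carrier_mat n n"
  shows "has_holo_calc f U M P \<longleftrightarrow> (\<exists>\<Gamma>. spectral_loop \<Gamma> U M n \<and> P = dunford_integral \<Gamma> M f)"
  using assms unfolding has_holo_calc_def spectral_loop_def dunford_integral_def by auto

lemma has_contour_integral_transform:
  assumes "(f has_contour_integral a) \<Gamma>" "\<And>w. w \<in> path_image \<Gamma> \<Longrightarrow> f w = g w" "a = b"
  shows "(g has_contour_integral b) \<Gamma>"
  using has_contour_integral_eq[OF assms(1,2)] assms(3) by simp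

context spectral_loop
begin

lemma spectrum_subset: "spectrum M \<subseteq> U"
  using wn_in wn_out by force

abbreviation \<Phi> where "\<Phi> \<equiv> dunford_integral \<Gamma> M"

lemma dunford_carrier [simp, intro]: "\<Phi> f \<in> carrier_mat n n"
  unfolding dunford_integral_def using M by auto

lemma dunford_entry:
  "i < n \<Longrightarrow> j < n \<Longrightarrow> \<Phi> f $$ (i, j) =
    1 / (2 * complex_of_real pi * \<i>) * contour_integral \<Gamma> (\<lambda>w. f w * resolvent M w $$ (i, j))"
  unfolding dunford_integral_def using M by auto

lemma notin_spectrum: "w \<in> path_image \<Gamma> \<Longrightarrow> w \<notin> spectrum M"
  using image by auto

lemma integrable:
  assumes "open U" "f holomorphic_on U" "i < n" "j < n"
  shows "(\<lambda>w. f w * resolvent M w $$ (i, j)) contour_integrable_on \<Gamma>"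
proof (rule contour_integrable_holomorphic_simple[OF _ _ valid image])
  show "open (U - spectrum M)"
    using assms(1) finite_spectrum[OF M] by (simp add: open_Diff finite_imp_closed)
  show "(\<lambda>w. f w * resolvent M w $$ (i, j)) holomorphic_on U - spectrum M"
    using holomorphic_on_subset[OF assms(2), of "U - spectrum M"]
      holomorphic_on_subset[OF resolvent_holomorphic[OF M assms(3,4)], of "U - spectrum M"]
    by (intro holomorphic_on_mult) auto
qed

lemma dunford_linear:
  assumes U: "open U" and f: "f holomorphic_on U" and g: "g holomorphic_on U"
  shows "\<Phi> (\<lambda>w. a * f w + g w) = a \<cdot>\<^sub>m \<Phi> f + \<Phi> g"
proof (rule eq_matI)
  fix i j assume "i < dim_row (a \<cdot>\<^sub>m \<Phi> f + \<Phi> g)" "j < dim_col (a \<cdot>\<^sub>m \<Phi> f + \<Phi> g)"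
  then have ij: "i < n" "j < n" using dunford_carrier[of f] dunford_carrier[of g] by auto
  have "contour_integral \<Gamma> (\<lambda>w. (a * f w + g w) * resolvent M w $$ (i, j)) =
     contour_integral \<Gamma> (\<lambda>w. a * (f w * resolvent M w $$ (i, j)) + g w * resolvent M w $$ (i, j))"
    by (simp add: algebra_simps)
  also have "\<dots> = a * contour_integral \<Gamma> (\<lambda>w. f w * resolvent M w $$ (i, j))
      + contour_integral \<Gamma> (\<lambda>w. g w * resolvent M w $$ (i, j))"
    using integrable[OF U f ij] integrable[OF U g ij]
    by (simp add: contour_integral_add contour_integral_lmul contour_integrable_lmul)
  finally show "\<Phi> (\<lambda>w. a * f w + g w) $$ (i, j) = (a \<cdot>\<^sub>m \<Phi> f + \<Phi> g) $$ (i, j)"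
    using ij carrier_matD[OF dunford_carrier[of f]] carrier_matD[OF dunford_carrier[of g]]
    by (simp add: dunford_entry) (simp add: field_simps)
qed (use carrier_matD[OF dunford_carrier] in auto)

text \<open>
  By $(w - l)(w - M)^{-1} = 1 + (M - l)(w - M)^{-1}$; the integral of $f$ itself vanishes by Cauchy's
  theorem.
\<close>
lemma dunford_shift:
  assumes U: "open U" and f: "f holomorphic_on U"
  shows "\<Phi> (\<lambda>w. (w - l) * f w) = (M - l \<cdot>\<^sub>m 1\<^sub>m n) * \<Phi> f"
proof (rule eq_matI)
  fix i j assume "i < dim_row ((M - l \<cdot>\<^sub>m 1\<^sub>m n) * \<Phi> f)" "j < dim_col ((M - l \<cdot>\<^sub>m 1\<^sub>m n) * \<Phi> f)"
  then have ij: "i < n" "j < n" using M carrier_matD[OF dunford_carrier[of f]] by auto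
  define C where "C = M - l \<cdot>\<^sub>m 1\<^sub>m n"
  have C: "C \<in> carrier_mat n n" unfolding C_def using M by auto
  have prod_entry: "(C * X) $$ (i, j) = (\<Sum>q<n. C $$ (i, q) * X $$ (q, j))"
    if "X \<in> carrier_mat n n" for X
    using that C ij by (simp add: scalar_prod_def lessThan_atLeast0)
  have zero: "(f has_contour_integral 0) \<Gamma>"
    using image wn_out by (intro Cauchy_theorem_global[OF U f valid loop]) auto
  have rows: "((\<lambda>w. f w * resolvent M w $$ (q, j)) has_contour_integral
      2 * complex_of_real pi * \<i> * \<Phi> f $$ (q, j)) \<Gamma>" if "q < n" for q
    using has_contour_integral_integral[OF integrable[OF U f that ij(2)]]
    by (simp add: dunford_entry[OF that ij(2)])
  have "((\<lambda>w. (1\<^sub>m n $$ (i, j)) * f w + (\<Sum>q<n. C $$ (i, q) * (f w * resolvent M w $$ (q, j))))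
      has_contour_integral (1\<^sub>m n $$ (i, j)) * 0 +
      (\<Sum>q<n. C $$ (i, q) * (2 * complex_of_real pi * \<i> * \<Phi> f $$ (q, j)))) \<Gamma>"
    by (intro has_contour_integral_add has_contour_integral_lmul has_contour_integral_sum zero rows) auto
  then have "((\<lambda>w. (w - l) * f w * resolvent M w $$ (i, j)) has_contour_integral
     (\<Sum>q<n. C $$ (i, q) * (2 * complex_of_real pi * \<i> * \<Phi> f $$ (q, j)))) \<Gamma>"
  proof (rule has_contour_integral_transform)
    fix w assume "w \<in> path_image \<Gamma>"
    note w = notin_spectrum[OF this]
    note r = resolvent_inverse(1)[OF M w]
    have "(w - l) * resolvent M w $$ (i, j) = ((w - l) \<cdot>\<^sub>m resolvent M w) $$ (i, j)"
      using r ij by (subst index_smult_mat) auto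
    also have "\<dots> = 1\<^sub>m n $$ (i, j) + (C * resolvent M w) $$ (i, j)"
      unfolding resolvent_shift_left[OF M w] C_def[symmetric]
      using mult_carrier_mat[OF C r] ij by (subst index_add_mat) auto
    finally have *: "(w - l) * resolvent M w $$ (i, j) =
       1\<^sub>m n $$ (i, j) + (\<Sum>q<n. C $$ (i, q) * resolvent M w $$ (q, j))"
      unfolding prod_entry[OF r] .
    have "(w - l) * f w * resolvent M w $$ (i, j) = f w * ((w - l) * resolvent M w $$ (i, j))"
      by (simp only: mult_ac)
    also have "\<dots> = 1\<^sub>m n $$ (i, j) * f w + (\<Sum>q<n. C $$ (i, q) * (f w * resolvent M w $$ (q, j)))"
      unfolding * distrib_left sum_distrib_left by (simp only: mult_ac)
    finally show "1\<^sub>m n $$ (i, j) * f w + (\<Sum>q<n. C $$ (i, q) * (f w * resolvent M w $$ (q, j)))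
       = (w - l) * f w * resolvent M w $$ (i, j)" ..
  qed simp
  then have "\<Phi> (\<lambda>w. (w - l) * f w) $$ (i, j) = 1 / (2 * complex_of_real pi * \<i>) *
      (\<Sum>q<n. C $$ (i, q) * (2 * complex_of_real pi * \<i> * \<Phi> f $$ (q, j)))"
    unfolding dunford_entry[OF ij] by (simp only: contour_integral_unique)
  also have "\<dots> = (C * \<Phi> f) $$ (i, j)"
    unfolding prod_entry[OF dunford_carrier] sum_distrib_left
    by (intro sum.cong refl) (simp add: field_simps)
  finally show "\<Phi> (\<lambda>w. (w - l) * f w) $$ (i, j) = ((M - l \<cdot>\<^sub>m 1\<^sub>m n) * \<Phi> f) $$ (i, j)"
    unfolding C_def .
qed (use M carrier_matD[OF dunford_carrier] in auto)

lemma dunford_shift_list: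
  assumes U: "open U" and f: "f holomorphic_on U"
  shows "\<Phi> (\<lambda>w. (\<Prod>l\<leftarrow>ls. w - l) * f w) = shift_apply M ls (\<Phi> f)"
  using f
proof (induction ls arbitrary: f)
  case (Cons l ls)
  have "(\<lambda>w. (w - l) * f w) holomorphic_on U" by (intro holomorphic_intros Cons.prems)
  from Cons.IH[OF this] show ?case
    using dunford_shift[OF U Cons.prems, of l] M by (simp add: mult_ac)
qed simp

text \<open>
  This is the place where the winding numbers matter.  The resolvent is expanded by
  \<open>resolvent_entry_step\<close>; only the term with a single factor in the denominator has a nonzero integral.
  The induction carries an additional denominator, given by the list \<open>ms\<close> of the eigenvalues already
  split off.
\<close>
lemma dunford_one: "\<Phi> (\<lambda>_. 1) = 1\<^sub>m n"
proof (rule eq_matI)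
  fix i j assume "i < dim_row (1\<^sub>m n :: complex mat)" "j < dim_col (1\<^sub>m n :: complex mat)"
  then have ij: "i < n" "j < n" by auto
  obtain ls where ls: "set ls \<subseteq> spectrum M" "shift_apply M ls (1\<^sub>m n) = 0\<^sub>m n n"
    using ex_annihilating_spectrum[OF M] by (metis one_carrier_mat)
  have "((\<lambda>w. (resolvent M w * X) $$ (i, j) / (\<Prod>l\<leftarrow>ms. w - l)) has_contour_integral
      (if ms = [] then 2 * complex_of_real pi * \<i> * X $$ (i, j) else 0)) \<Gamma>"
    if "X \<in> carrier_mat n n" "shift_apply M ls X = 0\<^sub>m n n" "set ms \<subseteq> spectrum M" for X ms
    using that ls(1)
  proof (induction ls arbitrary: X ms)
    case Nil
    have X0: "X = 0\<^sub>m n n" using Nil by simp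
    have "((\<lambda>w. 0) has_contour_integral 0) \<Gamma>" by (rule has_contour_integral_0)
    then have "((\<lambda>w. (resolvent M w * X) $$ (i, j) / (\<Prod>l\<leftarrow>ms. w - l)) has_contour_integral 0) \<Gamma>"
    proof (rule has_contour_integral_eq)
      fix w assume "w \<in> path_image \<Gamma>"
      then show "0 = (resolvent M w * X) $$ (i, j) / (\<Prod>l\<leftarrow>ms. w - l)"
        using ij unfolding X0 by (simp only: right_mult_zero_mat[OF resolvent_inverse(1)[OF M notin_spectrum]]) simp
    qed
    moreover have "(if ms = [] then 2 * complex_of_real pi * \<i> * X $$ (i, j) else 0) = 0"
      using X0 ij by simp
    ultimately show ?case by (simp only:)
  next
    case (Cons l ls)
    define Y where "Y = (M - l \<cdot>\<^sub>m 1\<^sub>m n) * X"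
    have Y: "Y \<in> carrier_mat n n" unfolding Y_def using M Cons.prems by (intro mult_carrier_mat) auto
    have IH: "((\<lambda>w. (resolvent M w * Y) $$ (i, j) / (\<Prod>l\<leftarrow>l # ms. w - l)) has_contour_integral 0) \<Gamma>"
      using Cons.IH[OF Y, of "l # ms"] Cons.prems M unfolding Y_def by simp
    have "((\<lambda>w. 1 / (\<Prod>l\<leftarrow>l # ms. w - l)) has_contour_integral
            (if length (l # ms) = 1 then 2 * complex_of_real pi * \<i> else 0)) \<Gamma>"
      using Cons.prems wn_in notin_spectrum
      by (intro has_contour_integral_inverse_prod_loop[OF valid loop]) auto
    from has_contour_integral_add[OF has_contour_integral_lmul[OF this, of "X $$ (i, j)"] IH]
    show ?case
    proof (rule has_contour_integral_transform)
      fix w assume "w \<in> path_image \<Gamma>"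
      note w = notin_spectrum[OF this]
      have "(resolvent M w * X) $$ (i, j) = (X $$ (i, j) + (resolvent M w * Y) $$ (i, j)) / (w - l)"
        using Cons.prems unfolding Y_def by (intro resolvent_entry_step[OF M w _ _ ij]) auto
      then show "X $$ (i, j) * (1 / (\<Prod>l\<leftarrow>l # ms. w - l)) +
          (resolvent M w * Y) $$ (i, j) / (\<Prod>l\<leftarrow>l # ms. w - l) =
          (resolvent M w * X) $$ (i, j) / (\<Prod>l\<leftarrow>ms. w - l)"
        by (simp only: list.map prod_list.Cons) (simp only: add_divide_distrib divide_divide_eq_left mult_1_right times_divide_eq_right)
    qed auto
  qed
  from this[OF one_carrier_mat ls(2), of "[]"]
  have "((\<lambda>w. (resolvent M w * 1\<^sub>m n) $$ (i, j)) has_contour_integral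
      2 * complex_of_real pi * \<i> * 1\<^sub>m n $$ (i, j)) \<Gamma>" by simp
  then have "((\<lambda>w. 1 * resolvent M w $$ (i, j)) has_contour_integral
      2 * complex_of_real pi * \<i> * 1\<^sub>m n $$ (i, j)) \<Gamma>"
  proof (rule has_contour_integral_eq)
    fix w assume "w \<in> path_image \<Gamma>"
    then show "(resolvent M w * 1\<^sub>m n) $$ (i, j) = 1 * resolvent M w $$ (i, j)"
      by (simp only: right_mult_one_mat[OF resolvent_inverse(1)[OF M notin_spectrum]] mult_1_left)
  qed
  then show "\<Phi> (\<lambda>_. 1) $$ (i, j) = 1\<^sub>m n $$ (i, j)"
    unfolding dunford_entry[OF ij] by (subst contour_integral_unique) auto
qed (use carrier_matD[OF dunford_carrier] in auto)

end


section \<open>Multiplicativity of the functional calculus\<close>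

lemma holomorphic_linear_factor:
  assumes "f holomorphic_on U" "open U" "l \<in> U"
  shows "\<exists>g. g holomorphic_on U \<and> (\<forall>w. f w = f l + (w - l) * g w)"
proof -
  define g where "g = (\<lambda>w. if w = l then deriv (\<lambda>w. f w - f l) l else (f w - f l) / (w - l))"
  have "(\<lambda>w. if w = l then deriv (\<lambda>w. f w - f l) l
       else (f w - f l) / (w - l) - (f l - f l) / (w - l)) holomorphic_on U"
    using assms by (intro pole_theorem_open) (auto intro!: holomorphic_intros)
  then have "g holomorphic_on U" unfolding g_def by (simp cong: if_cong)
  then show ?thesis unfolding g_def by (intro exI[of _ g] conjI) (auto simp: g_def)
qed

text \<open>
  The matrix $T$ depends on $f$ but neither on the loop nor on $g$.  It arises from Newton
  interpolation of $f$ at an annihilating list of eigenvalues: a factor $w - l$ under the integral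
  becomes a matrix factor $M - l$, and the remainder carries the whole product of these factors, which
  vanishes.  This replaces both the independence of the contour and the usual double integral over
  nested contours in the proof of multiplicativity.
\<close>
lemma dunford_mult_eq_matrix:
  assumes M: "M \<in> carrier_mat n n" and U: "open U" "spectrum M \<subseteq> U" and f: "f holomorphic_on U"
  shows "\<exists>T\<in>carrier_mat n n. \<forall>\<Gamma> g. spectral_loop \<Gamma> U M n \<longrightarrow> g holomorphic_on U \<longrightarrow>
    dunford_integral \<Gamma> M (\<lambda>w. f w * g w) = T * dunford_integral \<Gamma> M g"
proof -
  obtain ls where ls: "set ls \<subseteq> spectrum M"
    "\<forall>X\<in>carrier_mat n n. shift_apply M ls X = 0\<^sub>m n n"
    using ex_annihilating_spectrum[OF M] by blast
  have "\<exists>T\<in>carrier_mat n n. \<exists>F. F holomorphic_on U \<and>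
     (\<forall>\<Gamma> g. spectral_loop \<Gamma> U M n \<longrightarrow> g holomorphic_on U \<longrightarrow>
       dunford_integral \<Gamma> M (\<lambda>w. f w * g w) =
       T * dunford_integral \<Gamma> M g + dunford_integral \<Gamma> M (\<lambda>w. (\<Prod>l\<leftarrow>ls. w - l) * (F w * g w)))"
    using f ls(1)
  proof (induction ls arbitrary: f)
    case Nil
    show ?case
    proof (intro bexI[of _ "0\<^sub>m n n"] exI[of _ f] conjI allI impI)
      fix \<Gamma> g assume "spectral_loop \<Gamma> U M n"
      then interpret spectral_loop \<Gamma> U M n .
      show "\<Phi> (\<lambda>w. f w * g w) = 0\<^sub>m n n * \<Phi> g + \<Phi> (\<lambda>w. (\<Prod>l\<leftarrow>[]. w - l) * (f w * g w))"
        using left_mult_zero_mat[OF dunford_carrier] left_add_zero_mat[OF dunford_carrier] by simp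
    qed (use Nil in auto)
  next
    case (Cons l ls)
    obtain f1 where f1: "f1 holomorphic_on U" "\<And>w. f w = f l + (w - l) * f1 w"
      using holomorphic_linear_factor[OF Cons.prems(1) U(1), of l] Cons.prems(2) U(2) by auto
    obtain T F where T: "T \<in> carrier_mat n n" and F: "F holomorphic_on U"
      and eq: "\<And>\<Gamma> g. spectral_loop \<Gamma> U M n \<Longrightarrow> g holomorphic_on U \<Longrightarrow>
       dunford_integral \<Gamma> M (\<lambda>w. f1 w * g w) =
       T * dunford_integral \<Gamma> M g + dunford_integral \<Gamma> M (\<lambda>w. (\<Prod>l\<leftarrow>ls. w - l) * (F w * g w))"
      using Cons.IH[OF f1(1)] Cons.prems(2) by auto
    define C where "C = M - l \<cdot>\<^sub>m 1\<^sub>m n"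
    have C: "C \<in> carrier_mat n n" unfolding C_def using M by auto
    show ?case
    proof (intro bexI[of _ "f l \<cdot>\<^sub>m 1\<^sub>m n + T * C"] exI[of _ F] conjI allI impI F)
      show "f l \<cdot>\<^sub>m 1\<^sub>m n + T * C \<in> carrier_mat n n" using T C by auto
      fix \<Gamma> g assume "spectral_loop \<Gamma> U M n" and g: "g holomorphic_on U"
      then interpret spectral_loop \<Gamma> U M n by simp
      have lg: "(\<lambda>w. (w - l) * g w) holomorphic_on U" by (intro holomorphic_intros g)
      have f1lg: "(\<lambda>w. f1 w * ((w - l) * g w)) holomorphic_on U"
        by (intro holomorphic_intros g f1)
      have "\<Phi> (\<lambda>w. f w * g w) = \<Phi> (\<lambda>w. f l * g w + f1 w * ((w - l) * g w))"
        by (subst f1(2)) (simp add: algebra_simps)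
      also have "\<dots> = f l \<cdot>\<^sub>m \<Phi> g + \<Phi> (\<lambda>w. f1 w * ((w - l) * g w))"
        by (rule dunford_linear[OF U(1) g f1lg])
      also have "\<Phi> (\<lambda>w. f1 w * ((w - l) * g w)) = T * \<Phi> (\<lambda>w. (w - l) * g w)
          + \<Phi> (\<lambda>w. (\<Prod>l\<leftarrow>ls. w - l) * (F w * ((w - l) * g w)))"
        by (rule eq[OF spectral_loop_axioms lg])
      also have "\<Phi> (\<lambda>w. (w - l) * g w) = C * \<Phi> g"
        unfolding C_def by (rule dunford_shift[OF U(1) g])
      also have "T * (C * \<Phi> g) = T * C * \<Phi> g"
        by (rule assoc_mult_mat[OF T C dunford_carrier, symmetric])
      also have "(\<lambda>w. (\<Prod>l\<leftarrow>ls. w - l) * (F w * ((w - l) * g w))) =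
          (\<lambda>w. (\<Prod>l\<leftarrow>l # ls. w - l) * (F w * g w))"
        by (simp add: mult_ac)
      also have "f l \<cdot>\<^sub>m \<Phi> g + (T * C * \<Phi> g + \<Phi> (\<lambda>w. (\<Prod>l\<leftarrow>l # ls. w - l) * (F w * g w))) =
          (f l \<cdot>\<^sub>m \<Phi> g + T * C * \<Phi> g) + \<Phi> (\<lambda>w. (\<Prod>l\<leftarrow>l # ls. w - l) * (F w * g w))"
        using T C dunford_carrier
        by (intro assoc_add_mat[symmetric, of _ n n]) (auto intro!: mult_carrier_mat)
      also have "f l \<cdot>\<^sub>m \<Phi> g + T * C * \<Phi> g = (f l \<cdot>\<^sub>m 1\<^sub>m n + T * C) * \<Phi> g"
        unfolding add_mult_distrib_mat[OF smult_carrier_mat[OF one_carrier_mat]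
            mult_carrier_mat[OF T C] dunford_carrier]
          mult_smult_assoc_mat[OF one_carrier_mat dunford_carrier]
          left_mult_one_mat[OF dunford_carrier] ..
      finally show "\<Phi> (\<lambda>w. f w * g w) = (f l \<cdot>\<^sub>m 1\<^sub>m n + T * C) * \<Phi> g +
          \<Phi> (\<lambda>w. (\<Prod>l\<leftarrow>l # ls. w - l) * (F w * g w))" .
    qed
  qed
  then obtain T F where T: "T \<in> carrier_mat n n" and F: "F holomorphic_on U"
    and eq: "\<And>\<Gamma> g. spectral_loop \<Gamma> U M n \<Longrightarrow> g holomorphic_on U \<Longrightarrow>
       dunford_integral \<Gamma> M (\<lambda>w. f w * g w) =
       T * dunford_integral \<Gamma> M g + dunford_integral \<Gamma> M (\<lambda>w. (\<Prod>l\<leftarrow>ls. w - l) * (F w * g w))"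
    by auto
  show ?thesis
  proof (intro bexI[OF _ T] allI impI)
    fix \<Gamma> g assume "spectral_loop \<Gamma> U M n" and g: "g holomorphic_on U"
    then interpret spectral_loop \<Gamma> U M n by simp
    have "\<Phi> (\<lambda>w. (\<Prod>l\<leftarrow>ls. w - l) * (F w * g w)) = 0\<^sub>m n n"
      using ls(2) dunford_shift_list[OF U(1) holomorphic_on_mult[OF F g]] by simp
    with eq[OF spectral_loop_axioms g] show "\<Phi> (\<lambda>w. f w * g w) = T * \<Phi> g"
      using right_add_zero_mat[OF mult_carrier_mat[OF T dunford_carrier]] by simp
  qed
qed

text \<open>
  The three matrices may come from three different loops.  Taking $g = 1$ in
  \<open>dunford_mult_eq_matrix\<close> identifies its matrix $T$ with $f(M)$ computed along any loop, so that all
  three can be moved to a common one.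
\<close>
lemma has_holo_calc_mult:
  assumes M: "M \<in> carrier_mat n n" and U: "open U"
    and f: "f holomorphic_on U" and g: "g holomorphic_on U"
    and P: "has_holo_calc f U M P" and Q: "has_holo_calc g U M Q"
    and R: "has_holo_calc (\<lambda>w. f w * g w) U M R"
  shows "R = P * Q"
proof -
  obtain \<Gamma>\<^sub>P where P': "spectral_loop \<Gamma>\<^sub>P U M n" "P = dunford_integral \<Gamma>\<^sub>P M f"
    using P unfolding has_holo_calc_iff[OF M] by auto
  obtain \<Gamma>\<^sub>Q where Q': "spectral_loop \<Gamma>\<^sub>Q U M n" "Q = dunford_integral \<Gamma>\<^sub>Q M g"
    using Q unfolding has_holo_calc_iff[OF M] by auto
  obtain \<Gamma>\<^sub>R where R': "spectral_loop \<Gamma>\<^sub>R U M n" "R = dunford_integral \<Gamma>\<^sub>R M (\<lambda>w. f w * g w)"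
    using R unfolding has_holo_calc_iff[OF M] by auto
  have sub: "spectrum M \<subseteq> U" by (rule spectral_loop.spectrum_subset[OF P'(1)])
  have const: "\<exists>T\<in>carrier_mat n n. \<forall>\<Gamma>. spectral_loop \<Gamma> U M n \<longrightarrow>
      dunford_integral \<Gamma> M k = T \<and> (\<forall>m. m holomorphic_on U \<longrightarrow>
      dunford_integral \<Gamma> M (\<lambda>w. k w * m w) = T * dunford_integral \<Gamma> M m)"
    if k: "k holomorphic_on U" for k
  proof -
    obtain T where T: "T \<in> carrier_mat n n"
      and eq: "\<And>\<Gamma> m. spectral_loop \<Gamma> U M n \<Longrightarrow> m holomorphic_on U \<Longrightarrow>
        dunford_integral \<Gamma> M (\<lambda>w. k w * m w) = T * dunford_integral \<Gamma> M m"
      using dunford_mult_eq_matrix[OF M U sub k] by blast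
    have kT: "dunford_integral \<Gamma> M k = T" if "spectral_loop \<Gamma> U M n" for \<Gamma>
      using eq[OF that holomorphic_on_const[of 1]] T spectral_loop.dunford_one[OF that] by simp
    show ?thesis
      by (intro bexI[OF _ T] allI impI conjI) (rule kT, assumption, rule eq)
  qed
  obtain T where T: "\<And>\<Gamma>. spectral_loop \<Gamma> U M n \<Longrightarrow> dunford_integral \<Gamma> M f = T"
    "\<And>\<Gamma> m. spectral_loop \<Gamma> U M n \<Longrightarrow> m holomorphic_on U \<Longrightarrow>
        dunford_integral \<Gamma> M (\<lambda>w. f w * m w) = T * dunford_integral \<Gamma> M m"
    using const[OF f] by metis
  obtain S where S: "\<And>\<Gamma>. spectral_loop \<Gamma> U M n \<Longrightarrow> dunford_integral \<Gamma> M g = S"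
    using const[OF g] by metis
  show ?thesis
    unfolding P'(2) Q'(2) R'(2) T(2)[OF R'(1) g] S[OF R'(1)] S[OF Q'(1)] T(1)[OF P'(1)] ..
qed

lemma has_mat_powr_add:
  assumes "M \<in> carrier_mat n n" "has_mat_powr M \<alpha> P" "has_mat_powr M \<beta> Q" "has_mat_powr M (\<alpha> + \<beta>) R"
  shows "R = P * Q"
proof -
  have "(\<lambda>w. w powr complex_of_real (\<alpha> + \<beta>)) =
      (\<lambda>w. w powr complex_of_real \<alpha> * w powr complex_of_real \<beta>)"
    by (simp add: powr_add)
  with assms(4) have R: "has_holo_calc
      (\<lambda>w. w powr complex_of_real \<alpha> * w powr complex_of_real \<beta>) (- \<real>\<^sub>\<le>\<^sub>0) M R"
    unfolding has_mat_powr_def by simp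
  have hol: "(\<lambda>w. w powr complex_of_real \<gamma>) holomorphic_on - \<real>\<^sub>\<le>\<^sub>0" for \<gamma>
    by (rule holomorphic_on_powr[OF holomorphic_on_ident holomorphic_on_const]) (rule ComplD)
  have "open (- \<real>\<^sub>\<le>\<^sub>0 :: complex set)" by (rule open_Compl) (rule closed_nonpos_Reals_complex)
  from has_holo_calc_mult[OF assms(1) this hol hol assms(2,3)[unfolded has_mat_powr_def] R]
  show ?thesis .
qed


section \<open>Invertibility of the Lobatto IIIC matrix\<close>

lemma has_integral_poly_pderiv:
  fixes p :: "real poly"
  shows "(poly (pderiv p) has_integral poly p 1 - poly p 0) {0..1}"
  by (rule fundamental_theorem_of_calculus)
     (auto intro!: has_field_derivative_at_within poly_DERIV
       simp flip: has_real_derivative_iff_has_vector_derivative)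

lemma integral_X_pderiv:
  fixes p :: "real poly"
  shows "integral {0..1} (poly ([:0, 1:] * pderiv p)) = poly p 1 - integral {0..1} (poly p)"
proof -
  have int: "poly q integrable_on {0..1}" for q :: "real poly"
    by (intro integrable_continuous_real continuous_intros)
  have "pderiv ([:0, 1:] * p) = p + [:0, 1:] * pderiv p"
    by (simp add: pderiv_mult pderiv_pCons)
  then have "poly p 1 = integral {0..1} (\<lambda>x. poly p x + poly ([:0, 1:] * pderiv p) x)"
    using integral_unique[OF has_integral_poly_pderiv[of "[:0, 1:] * p"]]
    by (simp add: poly_add[abs_def] del: mult_pCons_left)
  also have "\<dots> = integral {0..1} (poly p) + integral {0..1} (poly ([:0, 1:] * pderiv p))"
    by (intro integral_add int)
  finally show ?thesis by simp
qed

text \<open>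
  With $Q = x^s (x - 1)^s$, this is the polynomial $Q^{(k)} / x^{s-k}$, for $k \le s$.
\<close>
fun lobatto_quotient :: "nat \<Rightarrow> nat \<Rightarrow> real poly" where
  "lobatto_quotient s 0 = [:- 1, 1:] ^ s"
| "lobatto_quotient s (Suc k) =
     Polynomial.smult (real (s - k)) (lobatto_quotient s k) + [:0, 1:] * pderiv (lobatto_quotient s k)"

lemma pderiv_iterate_lobatto:
  "k \<le> s \<Longrightarrow> (pderiv ^^ k) ([:0, 1:] ^ s * [:- 1, 1:] ^ s) = [:0, 1:] ^ (s - k) * lobatto_quotient s k"
proof (induction k)
  case (Suc k)
  obtain m where m: "s - k = Suc m" using Suc.prems by (cases "s - k") auto
  then have m': "s - Suc k = m" by auto
  have "(pderiv ^^ Suc k) ([:0, 1:] ^ s * [:- 1, 1:] ^ s :: real poly) =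
     pderiv ([:0, 1:] ^ Suc m * lobatto_quotient s k)"
    using Suc m by simp
  also have "\<dots> = [:0, 1:] ^ m * lobatto_quotient s (Suc k)"
    unfolding pderiv_mult pderiv_power_Suc m lobatto_quotient.simps
    by (simp add: pderiv_pCons algebra_simps)
  finally show ?case unfolding m' .
qed simp

lemma degree_lobatto_quotient: "degree (lobatto_quotient s k) \<le> s"
proof (induction k)
  case 0
  then show ?case using degree_power_le[of "[:- 1, 1 :: real:]" s] by simp
next
  case (Suc k)
  have "degree ([:0, 1:] * pderiv (lobatto_quotient s k)) \<le> s"
  proof (cases "pderiv (lobatto_quotient s k) = 0")
    case False
    then have "degree (lobatto_quotient s k) \<noteq> 0" using pderiv_eq_0_iff by blast
    then show ?thesis using Suc by (auto simp: degree_mult_eq degree_pderiv)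
  qed simp
  then show ?case using Suc
    by (auto intro!: degree_add_le order.trans[OF degree_smult_le])
qed

lemma lobatto_quotient_dvd: "k \<le> s \<Longrightarrow> [:- 1, 1:] ^ (s - k) dvd lobatto_quotient s k"
proof (induction k)
  case (Suc k)
  obtain m where m: "s - k = Suc m" using Suc.prems by (cases "s - k") auto
  then have m': "s - Suc k = m" by auto
  obtain q where q: "lobatto_quotient s k = [:- 1, 1:] ^ Suc m * q"
    using Suc m by (auto elim: dvdE)
  have "[:- 1, 1:] ^ m dvd lobatto_quotient s k"
    unfolding q power_Suc by (intro dvd_mult2 dvd_mult dvd_refl)
  moreover have "[:- 1, 1:] ^ m dvd pderiv (lobatto_quotient s k)"
    unfolding q pderiv_mult pderiv_power_Suc unfolding power_Suc2
    by (rule dvd_add[OF dvd_mult2[OF dvd_triv_left] dvd_mult[OF dvd_mult2[OF dvd_smult[OF dvd_refl]]]])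
  ultimately show ?case unfolding m' lobatto_quotient.simps
    by (intro dvd_add dvd_smult dvd_mult)
qed simp

text \<open>
  Integrating $x\,p'$ by parts gives
  $\int_0^1 S_{k+1} = (s - k - 1) \int_0^1 S_k + S_k(1)$ for $S_k = Q^{(k)} / x^{s-k}$, and the boundary
  term vanishes for $k < s$.  Hence $\int_0^1 S_{s-1}$ is a nonzero multiple of $\int_0^1 (x - 1)^s$.
\<close>
lemma integral_lobatto_quotient_nonzero:
  assumes "k < s"
  shows "integral {0..1} (poly (lobatto_quotient s k)) \<noteq> 0"
  using assms
proof (induction k)
  case 0
  have "integral {0..1} (poly (pderiv ([:- 1, 1 :: real:] ^ Suc s))) = - ((- 1) ^ Suc s)"
    using integral_unique[OF has_integral_poly_pderiv[of "[:- 1, 1:] ^ Suc s"]] by simp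
  moreover have "poly (pderiv ([:- 1, 1 :: real:] ^ Suc s)) = (\<lambda>x. real (Suc s) * poly ([:- 1, 1:] ^ s) x)"
    by (subst pderiv_power_Suc) (simp add: pderiv_pCons fun_eq_iff)
  moreover have "poly ([:- 1, 1 :: real:] ^ s) = (\<lambda>x. (x - 1) ^ s)"
    by (simp add: fun_eq_iff)
  ultimately have "real (Suc s) * integral {0..1} (poly ([:- 1, 1:] ^ s)) = - ((- 1) ^ Suc s)"
    by (simp del: of_nat_Suc)
  then show ?case by (metis lobatto_quotient.simps(1) mult_zero_right neg_equal_0_iff_equal
        power_eq_0_iff zero_neq_one)
next
  case (Suc k)
  have int: "poly q integrable_on {0..1}" for q :: "real poly"
    by (intro integrable_continuous_real continuous_intros)
  have "[:- 1, 1:] dvd [:- 1, 1 :: real:] ^ (s - k)" using Suc.prems by (intro dvd_power) auto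
  then have "[:- 1, 1:] dvd lobatto_quotient s k"
    using lobatto_quotient_dvd[of k s] Suc.prems dvd_trans by fastforce
  then have r: "poly (lobatto_quotient s k) 1 = 0" by (auto elim!: dvdE)
  have "integral {0..1} (poly (lobatto_quotient s (Suc k))) =
      integral {0..1} (\<lambda>x. real (s - k) * poly (lobatto_quotient s k) x
        + poly ([:0, 1:] * pderiv (lobatto_quotient s k)) x)"
    by (intro arg_cong[of _ _ "integral {0..1}"]) (simp add: fun_eq_iff)
  also have "\<dots> = integral {0..1} (\<lambda>x. real (s - k) * poly (lobatto_quotient s k) x)
      + integral {0..1} (poly ([:0, 1:] * pderiv (lobatto_quotient s k)))"
    by (intro integral_add integrable_on_mult_right int)
  also have "\<dots> = (real (s - k) - 1) * integral {0..1} (poly (lobatto_quotient s k))"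
    unfolding integral_X_pderiv r by (simp add: algebra_simps)
  finally have step: "integral {0..1} (poly (lobatto_quotient s (Suc k))) =
      (real (s - k) - 1) * integral {0..1} (poly (lobatto_quotient s k))" .
  have "real (s - k) - 1 \<noteq> 0" "integral {0..1} (poly (lobatto_quotient s k)) \<noteq> 0"
    using Suc by auto
  then show ?case unfolding step by simp
qed

text \<open>
  The polynomial $Q^{(s-1)} / x$ has degree at most $s$ and vanishes at all nodes after the first; it
  is therefore a multiple of the Lagrange polynomial of the first node, and its integral is nonzero.
\<close>
lemma lobatto_weight_0_nonzero:
  assumes s: "s \<ge> 1" and c: "lobatto_nodes s c" and b: "lobatto_weights s c b"
  shows "b 0 \<noteq> 0"
proof -
  define S where "S = lobatto_quotient s (s - 1)"
  define l where "l = lagrange_poly s c 0"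
  have inj: "inj_on c {0..s}" and c0: "c 0 = 0"
    and roots: "c ` {0..s} = {x. poly (lobatto_poly (s + 1)) x = 0}"
    using c strict_mono_on_imp_inj_on unfolding lobatto_nodes_def by auto
  have "lobatto_poly (s + 1) = [:0, 1:] * S"
    using pderiv_iterate_lobatto[of "s - 1" s] s unfolding lobatto_poly_def S_def by simp
  then have S0: "poly S (c i) = 0" if "i \<in> {1..s}" for i
  proof -
    have "c i \<noteq> 0" using inj_onD[OF inj, of i 0] c0 that by auto
    moreover have "poly (lobatto_poly (s + 1)) (c i) = 0" using roots that by auto
    ultimately show ?thesis using \<open>lobatto_poly (s + 1) = [:0, 1:] * S\<close> by simp
  qed
  define p where "p = S - Polynomial.smult (poly S 0) l"
  have "p = 0"
  proof (rule ccontr)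
    assume p: "p \<noteq> 0"
    have "degree p \<le> s"
      unfolding p_def S_def l_def using degree_lobatto_quotient degree_lagrange_poly[OF inj, of 0]
      by (intro degree_diff_le) auto
    moreover have "c ` {0..s} \<subseteq> {x. poly p x = 0}"
    proof safe
      fix i assume "i \<in> {0..s}"
      then show "poly p (c i) = 0"
        using poly_lagrange_poly_node[OF inj, of 0 i] S0[of i] c0
        unfolding p_def l_def by (cases "i = 0") auto
    qed
    then have "card (c ` {0..s}) \<le> card {x. poly p x = 0}"
      using poly_roots_finite[OF p] by (intro card_mono)
    then have "s + 1 \<le> card {x. poly p x = 0}" using card_image[OF inj] by simp
    ultimately show False using card_poly_roots_bound[OF p] by simp
  qed
  then have "poly S = (\<lambda>x. poly S 0 * poly l x)" unfolding p_def
    by (metis eq_iff_diff_eq_0 poly_smult ext)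
  then have "integral {0..1} (poly S) = poly S 0 * integral {0..1} (poly l)"
    by (metis integral_mult_right)
  moreover have "integral {0..1} (poly S) \<noteq> 0"
    unfolding S_def using s by (intro integral_lobatto_quotient_nonzero) auto
  ultimately show ?thesis using b unfolding lobatto_weights_def l_def by auto
qed

lemma moments_zero_imp_zero:
  fixes c u :: "nat \<Rightarrow> real"
  assumes inj: "inj_on c {0..s}" and mom: "\<And>q. q \<le> s \<Longrightarrow> (\<Sum>i=0..s. u i * c i ^ q) = 0"
    and "\<nu> \<le> s"
  shows "u \<nu> = 0"
proof -
  have "(\<Sum>i=0..s. u i * poly (lagrange_poly s c \<nu>) (c i)) =
      (\<Sum>i=0..s. \<Sum>q\<le>s. coeff (lagrange_poly s c \<nu>) q * (u i * c i ^ q))"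
    unfolding poly_altdef degree_lagrange_poly[OF inj \<open>\<nu> \<le> s\<close>] sum_distrib_left
    by (simp add: mult_ac)
  also have "\<dots> = (\<Sum>q\<le>s. coeff (lagrange_poly s c \<nu>) q * (\<Sum>i=0..s. u i * c i ^ q))"
    unfolding sum_distrib_left by (rule sum.swap)
  also have "\<dots> = 0" using mom by simp
  also have "(\<Sum>i=0..s. u i * poly (lagrange_poly s c \<nu>) (c i)) = (\<Sum>i=0..s. if i = \<nu> then u i else 0)"
    using poly_lagrange_poly_node[OF inj \<open>\<nu> \<le> s\<close>] by (intro sum.cong) auto
  also have "\<dots> = u \<nu>" using \<open>\<nu> \<le> s\<close> by simp
  finally show ?thesis .
qed

text \<open>
  Let $u^\top A = 0$.  The first column of $A$ has constant entries $b_1 \ne 0$, so $\sum_i u_i = 0$;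
  the order conditions give $\sum_i u_i c_i^q = 0$ for $q = 1, \dots, s$.  As the nodes are distinct,
  $u = 0$.
\<close>
lemma lobatto_IIIC_det_nonzero:
  assumes s: "s \<ge> 1" and A: "lobatto_IIIC s c b A"
  shows "Determinant.det A \<noteq> 0"
proof
  assume "Determinant.det A = 0"
  have c: "lobatto_nodes s c" and b: "lobatto_weights s c b" and cA: "A \<in> carrier_mat (s + 1) (s + 1)"
    and col0: "\<And>i. i \<le> s \<Longrightarrow> A $$ (i, 0) = b 0"
    and order: "\<And>q i. 1 \<le> q \<Longrightarrow> q \<le> s \<Longrightarrow> i \<le> s \<Longrightarrow>
      (\<Sum>j=0..s. A $$ (i, j) * c j ^ (q - 1)) = c i ^ q / real q"
    using A unfolding lobatto_IIIC_def by auto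
  have inj: "inj_on c {0..s}" using c strict_mono_on_imp_inj_on unfolding lobatto_nodes_def by auto
  have "Determinant.det (transpose_mat A) = 0" using \<open>Determinant.det A = 0\<close> det_transpose[OF cA] by simp
  then obtain v where v: "v \<in> carrier_vec (s + 1)" "v \<noteq> 0\<^sub>v (s + 1)"
    "transpose_mat A *\<^sub>v v = 0\<^sub>v (s + 1)"
    using det_0_iff_vec_prod_zero[of "transpose_mat A" "s + 1"] cA by auto
  define u where "u i = vec_index v i" for i
  have left_null: "(\<Sum>i=0..s. u i * A $$ (i, j)) = 0" if "j \<le> s" for j
  proof -
    have "vec_index (transpose_mat A *\<^sub>v v) j = (\<Sum>i=0..<s+1. A $$ (i, j) * u i)"
      using that cA v(1) by (simp add: scalar_prod_def u_def)
    then show ?thesis using v(3) that by (simp add: mult.commute atLeastLessThanSuc_atLeastAtMost)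
  qed
  have "(\<Sum>i=0..s. u i * c i ^ q) = 0" if "q \<le> s" for q
  proof (cases "q = 0")
    case True
    have "(\<Sum>i=0..s. u i) * b 0 = (\<Sum>i=0..s. u i * A $$ (i, 0))"
      unfolding sum_distrib_right using col0 by (intro sum.cong) auto
    then show ?thesis using True left_null[of 0] lobatto_weight_0_nonzero[OF s c b] by simp
  next
    case False
    have "(\<Sum>i=0..s. u i * (c i ^ q / real q)) = (\<Sum>i=0..s. \<Sum>j=0..s. u i * A $$ (i, j) * c j ^ (q - 1))"
      using order[of q] False that
      by (intro sum.cong) (auto simp: sum_distrib_left mult.assoc simp flip: sum_distrib_left)
    also have "\<dots> = (\<Sum>j=0..s. (\<Sum>i=0..s. u i * A $$ (i, j)) * c j ^ (q - 1))"
      unfolding sum_distrib_right by (rule sum.swap)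
    also have "\<dots> = 0" using left_null by simp
    finally have "(\<Sum>i=0..s. u i * c i ^ q) / real q = 0"
      unfolding sum_divide_distrib by simp
    then show ?thesis using False by simp
  qed
  then have "u i = 0" if "i \<le> s" for i by (rule moments_zero_imp_zero[OF inj _ that])
  then have "v = 0\<^sub>v (s + 1)" using v(1) unfolding u_def by (intro eq_vecI) auto
  with v(2) show False by simp
qed


section \<open>Convolution of the quadrature weights\<close>

text \<open>
  Here the invertibility of $A$ enters: the value of \<^const>\<open>mat_inverse\<close> at a singular matrix is
  \<^const>\<open>None\<close>, and \<open>mat_inv\<close> would be a matrix of unknown dimensions.
\<close>
lemma mat_inv_lobatto_carrier:
  assumes "s \<ge> 1" "lobatto_IIIC s c b A"
  shows "mat_inv (map_mat complex_of_real A) \<in> carrier_mat (s + 1) (s + 1)"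
proof (rule mat_inv_of_det)
  show "map_mat complex_of_real A \<in> carrier_mat (s + 1) (s + 1)"
    using assms unfolding lobatto_IIIC_def by auto
  show "Determinant.det (map_mat complex_of_real A) \<noteq> 0"
    using lobatto_IIIC_det_nonzero[OF assms] by (simp add: of_real_hom.hom_det)
qed

lemma rk_symbol_carrier:
  assumes "s \<ge> 1" "lobatto_IIIC s c b A"
  shows "rk_symbol s A b z \<in> carrier_mat (s + 1) (s + 1)"
proof -
  note A' = mat_inv_lobatto_carrier[OF assms]
  have "mat (s + 1) 1 (\<lambda>_. 1 :: complex) \<in> carrier_mat (s + 1) 1"
    "mat 1 (s + 1) (\<lambda>(_, j). complex_of_real (b j)) \<in> carrier_mat 1 (s + 1)" by auto
  from mult_carrier_mat[OF mult_carrier_mat[OF mult_carrier_mat[OF A' this(1)] this(2)] A']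
  show ?thesis unfolding rk_symbol_def Let_def by (intro minus_carrier_mat smult_carrier_mat)
qed

lemma has_fps_expansion_of_sums:
  fixes a :: "nat \<Rightarrow> complex"
  assumes "R > 0" "\<And>z. norm z < R \<Longrightarrow> (\<lambda>n. a n * z ^ n) sums f z"
  shows "f has_fps_expansion Abs_fps a"
proof (unfold has_fps_expansion_def, intro conjI)
  have "ereal R \<le> conv_radius a"
  proof (rule conv_radius_geI_ex')
    fix r assume "0 < r" "ereal r < ereal R"
    then show "summable (\<lambda>n. a n * of_real r ^ n)"
      using assms(2)[of "of_real r"] by (auto intro: sums_summable)
  qed
  then show "fps_conv_radius (Abs_fps a) > 0"
    using less_le_trans[of 0 "ereal R" "conv_radius a"] assms(1) unfolding fps_conv_radius_def
    by (simp add: zero_ereal_def)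
  show "eventually (\<lambda>z. eval_fps (Abs_fps a) z = f z) (nhds 0)"
    unfolding eventually_nhds_metric eval_fps_def
    using assms by (intro exI[of _ R]) (auto simp: sums_iff)
qed

text \<open>
  Comparison of coefficients in
  $(\gamma(z)/h)^{\alpha + \beta} = (\gamma(z)/h)^\alpha (\gamma(z)/h)^\beta$, which holds for all
  sufficiently small $z$.
\<close>
lemma cq_weights_convolution:
  assumes carrier: "\<And>z. rk_symbol s A b z \<in> carrier_mat (s + 1) (s + 1)"
    and V: "cq_weights s A b h \<alpha> V" and W: "cq_weights s A b h \<beta> W"
    and X: "cq_weights s A b h (\<alpha> + \<beta>) X" and ij: "i \<le> s" "j \<le> s"
  shows "X n $$ (i, j) = (\<Sum>m=0..n. \<Sum>q=0..s. V m $$ (i, q) * W (n - m) $$ (q, j))"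
proof -
  define M where "M z = complex_of_real (1 / h) \<cdot>\<^sub>m rk_symbol s A b z" for z
  have M: "M z \<in> carrier_mat (s + 1) (s + 1)" for z
    unfolding M_def by (rule smult_carrier_mat[OF carrier])
  have ex: "\<exists>P R. R > 0 \<and> (\<forall>z. norm z < R \<longrightarrow> has_mat_powr (M z) \<gamma> (P z) \<and>
      (\<forall>i\<le>s. \<forall>j\<le>s. (\<lambda>n. complex_of_real (Y n $$ (i, j)) * z ^ n) sums (P z $$ (i, j))))"
    if "cq_weights s A b h \<gamma> Y" for \<gamma> Y
    using that unfolding cq_weights_def M_def[symmetric] by metis
  obtain P\<^sub>V R\<^sub>V where V': "R\<^sub>V > 0" "\<And>z. norm z < R\<^sub>V \<Longrightarrow> has_mat_powr (M z) \<alpha> (P\<^sub>V z)"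
    "\<And>z i j. norm z < R\<^sub>V \<Longrightarrow> i \<le> s \<Longrightarrow> j \<le> s \<Longrightarrow>
      (\<lambda>n. complex_of_real (V n $$ (i, j)) * z ^ n) sums (P\<^sub>V z $$ (i, j))"
    using ex[OF V] by blast
  obtain P\<^sub>W R\<^sub>W where W': "R\<^sub>W > 0" "\<And>z. norm z < R\<^sub>W \<Longrightarrow> has_mat_powr (M z) \<beta> (P\<^sub>W z)"
    "\<And>z i j. norm z < R\<^sub>W \<Longrightarrow> i \<le> s \<Longrightarrow> j \<le> s \<Longrightarrow>
      (\<lambda>n. complex_of_real (W n $$ (i, j)) * z ^ n) sums (P\<^sub>W z $$ (i, j))"
    using ex[OF W] by blast
  obtain P\<^sub>X R\<^sub>X where X': "R\<^sub>X > 0" "\<And>z. norm z < R\<^sub>X \<Longrightarrow> has_mat_powr (M z) (\<alpha> + \<beta>) (P\<^sub>X z)"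
    "\<And>z i j. norm z < R\<^sub>X \<Longrightarrow> i \<le> s \<Longrightarrow> j \<le> s \<Longrightarrow>
      (\<lambda>n. complex_of_real (X n $$ (i, j)) * z ^ n) sums (P\<^sub>X z $$ (i, j))"
    using ex[OF X] by blast
  let ?fps = "\<lambda>Y i j. Abs_fps (\<lambda>n. complex_of_real (Y n $$ (i, j)))"
  \<comment> \<open>both sides are compared as power series, so that equality near $0$ suffices\<close>
  have FV: "(\<lambda>z. P\<^sub>V z $$ (i, q)) has_fps_expansion ?fps V i q" if "q \<le> s" for q
    using that ij V' by (intro has_fps_expansion_of_sums) auto
  have FW: "(\<lambda>z. P\<^sub>W z $$ (q, j)) has_fps_expansion ?fps W q j" if "q \<le> s" for q
    using that ij W' by (intro has_fps_expansion_of_sums) auto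
  have FX: "(\<lambda>z. P\<^sub>X z $$ (i, j)) has_fps_expansion ?fps X i j"
    using ij X' by (intro has_fps_expansion_of_sums) auto
  have prod: "P\<^sub>X z $$ (i, j) = (\<Sum>q=0..s. P\<^sub>V z $$ (i, q) * P\<^sub>W z $$ (q, j))"
    if z: "norm z < min R\<^sub>V (min R\<^sub>W R\<^sub>X)" for z
  proof -
    have powr: "has_mat_powr (M z) \<alpha> (P\<^sub>V z)" "has_mat_powr (M z) \<beta> (P\<^sub>W z)"
      using V'(2) W'(2) z by auto
    then have c: "P\<^sub>V z \<in> carrier_mat (s + 1) (s + 1)" "P\<^sub>W z \<in> carrier_mat (s + 1) (s + 1)"
      using M[of z] unfolding has_mat_powr_def has_holo_calc_def by auto
    have "P\<^sub>X z = P\<^sub>V z * P\<^sub>W z"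
      using X'(2)[of z] z by (intro has_mat_powr_add[OF M powr]) auto
    then show ?thesis
      using c ij by (simp add: scalar_prod_def atLeastLessThanSuc_atLeastAtMost)
  qed
  have 1: "(\<lambda>z. \<Sum>q=0..s. P\<^sub>V z $$ (i, q) * P\<^sub>W z $$ (q, j)) has_fps_expansion
      (\<Sum>q=0..s. ?fps V i q * ?fps W q j)"
    using FV FW by (intro has_fps_expansion_sum has_fps_expansion_mult) auto
  have 2: "eventually (\<lambda>z. P\<^sub>X z $$ (i, j) = (\<Sum>q=0..s. P\<^sub>V z $$ (i, q) * P\<^sub>W z $$ (q, j))) (nhds 0)"
    unfolding eventually_nhds_metric
    using V'(1) W'(1) X'(1) prod by (intro exI[of _ "min R\<^sub>V (min R\<^sub>W R\<^sub>X)"]) auto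
  have "(\<lambda>z. P\<^sub>X z $$ (i, j)) has_fps_expansion (\<Sum>q=0..s. ?fps V i q * ?fps W q j)"
    by (rule iffD2[OF has_fps_expansion_cong[OF 2 refl] 1])
  then have "?fps X i j = (\<Sum>q=0..s. ?fps V i q * ?fps W q j)"
    using FX fps_expansion_unique_complex by blast
  then have "fps_nth (?fps X i j) n = fps_nth (\<Sum>q=0..s. ?fps V i q * ?fps W q j) n" by simp
  also have "\<dots> = (\<Sum>q=0..s. \<Sum>m=0..n.
      complex_of_real (V m $$ (i, q)) * complex_of_real (W (n - m) $$ (q, j)))"
    by (simp add: fps_sum_nth fps_mult_nth)
  also have "\<dots> = complex_of_real (\<Sum>q=0..s. \<Sum>m=0..n. V m $$ (i, q) * W (n - m) $$ (q, j))"
    by simp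
  finally have "X n $$ (i, j) = (\<Sum>q=0..s. \<Sum>m=0..n. V m $$ (i, q) * W (n - m) $$ (q, j))"
    by (simp only: fps_nth_Abs_fps of_real_eq_iff)
  then show ?thesis by (subst sum.swap)
qed


section \<open>Fractional difference operators\<close>

lemma sum_triangle_diff:
  fixes g :: "nat \<Rightarrow> nat \<Rightarrow> 'a::comm_monoid_add"
  shows "(\<Sum>m=0..k. \<Sum>l=0..k - m. g m l) = (\<Sum>n=0..k. \<Sum>m=0..n. g m (n - m))"
proof -
  have "(\<Sum>m=0..k. \<Sum>l=0..k - m. g m l) = (\<Sum>(m, l)\<in>(SIGMA m:{0..k}. {0..k - m}). g m l)"
    by (rule sum.Sigma) auto
  also have "(SIGMA m:{0..k}. {0..k - m}) = {(m, l). m + l \<le> k}" by auto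
  finally show ?thesis unfolding sum.triangle_reindex_eq atMost_atLeast0 .
qed

lemma sum_triangle_swap:
  fixes g :: "nat \<Rightarrow> nat \<Rightarrow> 'a::comm_monoid_add"
  shows "(\<Sum>k=0..N. \<Sum>l=k..N. g k l) = (\<Sum>l=0..N. \<Sum>k=0..l. g k l)"
proof -
  have "(\<Sum>(k, l)\<in>(SIGMA k:{0..N}. {k..N}). g k l) = (\<Sum>(l, k)\<in>(SIGMA l:{0..N}. {0..l}). g k l)"
    by (rule sum.reindex_bij_witness[where i = "\<lambda>(l, k). (k, l)" and j = "\<lambda>(k, l). (l, k)"]) auto
  then show ?thesis by (simp add: sum.Sigma)
qed


lemma cq_minus_linear:
  "cq_minus s W (\<lambda>k i. f k i + \<epsilon> *\<^sub>R g k i) k i = cq_minus s W f k i + \<epsilon> *\<^sub>R cq_minus s W g k i"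
  unfolding cq_minus_def
  by (simp add: scaleR_add_right sum.distrib scaleR_sum_right mult.commute)

lemma cq_minus_cq_minus:
  assumes conv: "\<And>n i j. i \<le> s \<Longrightarrow> j \<le> s \<Longrightarrow>
      X n $$ (i, j) = (\<Sum>m=0..n. \<Sum>q=0..s. V m $$ (i, q) * W (n - m) $$ (q, j))"
    and i: "i \<le> s"
  shows "cq_minus s V (cq_minus s W f) k i = cq_minus s X f k i"
proof -
  let ?g = "\<lambda>m l. \<Sum>q=0..s. \<Sum>j=0..s. (V m $$ (i, q) * W l $$ (q, j)) *\<^sub>R f (k - (m + l)) j"
  have "cq_minus s V (cq_minus s W f) k i = (\<Sum>m=0..k. \<Sum>q=0..s. \<Sum>l=0..k - m. \<Sum>j=0..s.
      (V m $$ (i, q) * W l $$ (q, j)) *\<^sub>R f (k - (m + l)) j)"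
    unfolding cq_minus_def by (simp add: scaleR_sum_right)
  also have "\<dots> = (\<Sum>m=0..k. \<Sum>l=0..k - m. ?g m l)"
    by (intro sum.cong refl sum.swap)
  also have "\<dots> = (\<Sum>n=0..k. \<Sum>m=0..n. ?g m (n - m))"
    by (rule sum_triangle_diff)
  also have "\<dots> = (\<Sum>n=0..k. \<Sum>j=0..s. X n $$ (i, j) *\<^sub>R f (k - n) j)"
  proof (rule sum.cong[OF refl])
    fix n assume "n \<in> {0..k}"
    have "(\<Sum>m=0..n. ?g m (n - m)) = (\<Sum>m=0..n. \<Sum>j=0..s. \<Sum>q=0..s.
       (V m $$ (i, q) * W (n - m) $$ (q, j)) *\<^sub>R f (k - n) j)"
      by (intro sum.cong[OF refl] trans[OF sum.swap]) auto
    also have "\<dots> = (\<Sum>j=0..s. \<Sum>m=0..n. \<Sum>q=0..s.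
       (V m $$ (i, q) * W (n - m) $$ (q, j)) *\<^sub>R f (k - n) j)"
      by (rule sum.swap)
    also have "\<dots> = (\<Sum>j=0..s. X n $$ (i, j) *\<^sub>R f (k - n) j)"
      using conv[OF i] by (intro sum.cong refl) (simp add: scaleR_sum_left)
    finally show "(\<Sum>m=0..n. ?g m (n - m)) = (\<Sum>j=0..s. X n $$ (i, j) *\<^sub>R f (k - n) j)" .
  qed
  finally show ?thesis unfolding cq_minus_def .
qed

text \<open>
  Discrete integration by parts.  $\mathcal{D}_-$ looks back to step $0$ and $\mathcal{D}_+$ ahead to
  step $N$, so both sides sum the terms with $W_{l-k}$ over the same pairs $k \le l \le N$, and there are
  no boundary terms.
\<close>
lemma cq_plus_adjoint:
  fixes f g :: "nat \<Rightarrow> nat \<Rightarrow> 'a::real_inner"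
  assumes carrier: "\<And>n. W n \<in> carrier_mat (s + 1) (s + 1)"
  shows "(\<Sum>k=0..N. \<Sum>i=0..s. inner (cq_plus s N W f k i) (g k i)) =
    (\<Sum>k=0..N. \<Sum>i=0..s. inner (f k i) (cq_minus s W g k i))"
proof -
  define T where "T k l = (\<Sum>i=0..s. \<Sum>j=0..s. W (l - k) $$ (j, i) * inner (f l j) (g k i))" for k l
  have "(\<Sum>k=0..N. \<Sum>i=0..s. inner (cq_plus s N W f k i) (g k i)) = (\<Sum>k=0..N. \<Sum>l=k..N. T k l)"
  proof (rule sum.cong[OF refl])
    fix k assume k: "k \<in> {0..N}"
    have "(\<Sum>i=0..s. inner (cq_plus s N W f k i) (g k i)) =
      (\<Sum>i=0..s. \<Sum>n=0..N-k. \<Sum>j=0..s. W n $$ (j, i) * inner (f (k + n) j) (g k i))"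
      unfolding cq_plus_def inner_sum_left
    proof (intro sum.cong refl)
      fix i n j assume "i \<in> {0..s}" "j \<in> {0..s}"
      then show "inner (transpose_mat (W n) $$ (i, j) *\<^sub>R f (k + n) j) (g k i) =
          W n $$ (j, i) * inner (f (k + n) j) (g k i)"
        using carrier[of n] by (subst index_transpose_mat) auto
    qed
    also have "\<dots> = (\<Sum>n=0..N-k. \<Sum>i=0..s. \<Sum>j=0..s. W n $$ (j, i) * inner (f (k + n) j) (g k i))"
      by (rule sum.swap)
    also have "\<dots> = (\<Sum>n=0..N-k. T k (n + k))" unfolding T_def by (simp add: add.commute)
    also have "\<dots> = (\<Sum>l=0+k..N-k+k. T k l)" by (rule sum.shift_bounds_cl_nat_ivl[symmetric])
    finally show "(\<Sum>i=0..s. inner (cq_plus s N W f k i) (g k i)) = (\<Sum>l=k..N. T k l)" using k by simp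
  qed
  also have "\<dots> = (\<Sum>l=0..N. \<Sum>k=0..l. T k l)"
    by (rule sum_triangle_swap)
  also have "\<dots> = (\<Sum>k=0..N. \<Sum>i=0..s. inner (f k i) (cq_minus s W g k i))"
  proof (rule sum.cong[OF refl])
    fix l assume "l \<in> {0..N}"
    have "(\<Sum>k=0..l. T k l) = (\<Sum>n=0..l. T (l - n) l)"
      using sum.atLeastAtMost_rev[of "\<lambda>k. T k l" 0 l] by simp
    also have "\<dots> = (\<Sum>n=0..l. \<Sum>i=0..s. \<Sum>j=0..s. W n $$ (j, i) * inner (f l j) (g (l - n) i))"
      unfolding T_def by (intro sum.cong refl) auto
    also have "\<dots> = (\<Sum>n=0..l. \<Sum>j=0..s. \<Sum>i=0..s. W n $$ (j, i) * inner (f l j) (g (l - n) i))"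
      by (intro sum.cong refl sum.swap)
    also have "\<dots> = (\<Sum>j=0..s. \<Sum>n=0..l. \<Sum>i=0..s. W n $$ (j, i) * inner (f l j) (g (l - n) i))"
      by (rule sum.swap)
    also have "\<dots> = (\<Sum>j=0..s. inner (f l j) (cq_minus s W g l j))"
      unfolding cq_minus_def by (simp add: inner_sum_right)
    finally show "(\<Sum>k=0..l. T k l) = (\<Sum>i=0..s. inner (f l i) (cq_minus s W g l i))" .
  qed
  finally show ?thesis .
qed


section \<open>First variation of the discrete Lagrangian\<close>

lemma vector_derivative_interp:
  fixes X :: "nat \<Rightarrow> 'a::real_normed_vector"
  shows "vector_derivative (interp s d h X) (at t) =
    (\<Sum>\<nu>=0..s. (poly (pderiv (lagrange_poly s d \<nu>)) (t / h) / h) *\<^sub>R X \<nu>)"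
proof (rule vector_derivative_at)
  have d: "((\<lambda>t. poly (lagrange_poly s d \<nu>) (t / h) *\<^sub>R X \<nu>) has_vector_derivative
      (poly (pderiv (lagrange_poly s d \<nu>)) (t / h) / h) *\<^sub>R X \<nu>) (at t)" for \<nu>
  proof -
    have "((\<lambda>t. t / h) has_real_derivative 1 / h) (at t)"
      by (rule DERIV_cdivide[OF DERIV_ident])
    from has_vector_derivative_scaleR[OF DERIV_chain2[OF poly_DERIV this] has_vector_derivative_const]
    show ?thesis by simp
  qed
  show "(interp s d h X has_vector_derivative
      (\<Sum>\<nu>=0..s. (poly (pderiv (lagrange_poly s d \<nu>)) (t / h) / h) *\<^sub>R X \<nu>)) (at t)"
    unfolding interp_def[abs_def] by (rule has_vector_derivative_sum) (rule d)
qed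

lemma bounded_linear_inner_representation:
  fixes \<phi> :: "'a::euclidean_space \<Rightarrow> real"
  assumes "bounded_linear \<phi>"
  shows "\<exists>g. \<forall>v. \<phi> v = inner g v"
proof -
  interpret bounded_linear \<phi> by fact
  have "\<phi> v = inner (\<Sum>b\<in>Basis. \<phi> b *\<^sub>R b) v" for v
  proof -
    have "\<phi> v = \<phi> (\<Sum>b\<in>Basis. inner v b *\<^sub>R b)" by (simp add: euclidean_representation)
    also have "\<dots> = (\<Sum>b\<in>Basis. inner v b * \<phi> b)" by (simp add: sum scaleR)
    also have "\<dots> = inner (\<Sum>b\<in>Basis. \<phi> b *\<^sub>R b) v"
      by (simp add: inner_sum_right inner_commute[of _ v] mult.commute)
    finally show ?thesis .
  qed
  then show ?thesis by blast
qed

text \<open>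
  The contribution of the value $v$ at the $\nu$-th control point to position and velocity of the
  interpolating curve at time $t$.
\<close>
definition node_state ::
  "nat \<Rightarrow> (nat \<Rightarrow> real) \<Rightarrow> real \<Rightarrow> real \<Rightarrow> nat \<Rightarrow> 'a::real_vector \<Rightarrow> 'a \<times> 'a" where
  "node_state s d h t \<nu> v = (poly (lagrange_poly s d \<nu>) (t / h) *\<^sub>R v,
     (poly (pderiv (lagrange_poly s d \<nu>)) (t / h) / h) *\<^sub>R v)"

lemma bounded_linear_node_state:
  "bounded_linear (node_state s d h t \<nu> :: 'a::real_normed_vector \<Rightarrow> _)"
  unfolding node_state_def[abs_def]
  by (intro bounded_linear_Pair bounded_linear_scaleR_right)

lemma discrete_lagrangian_eq:
  "discrete_lagrangian s c b d h L X =
    h * (\<Sum>i=0..s. b i * L (\<Sum>\<nu>=0..s. node_state s d h (c i * h) \<nu> (X \<nu>)))"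
  unfolding discrete_lagrangian_def vector_derivative_interp interp_def node_state_def
  by (simp add: sum_prod)

text \<open>
  The partial derivative of the discrete Lagrangian at $X$ with respect to its $\nu$-th argument, in
  direction $v$, when \<open>L'\<close> is the derivative of the Lagrangian.
\<close>
definition stage_differential where
  "stage_differential s c b d h L' X \<nu> v = h * (\<Sum>i=0..s. b i *
     L' (\<Sum>\<mu>=0..s. node_state s d h (c i * h) \<mu> (X \<mu>)) (node_state s d h (c i * h) \<nu> v))"

lemma discrete_lagrangian_chain_rule:
  fixes L :: "(real ^ 'd) \<times> (real ^ 'd) \<Rightarrow> real" and Y :: "'e::real_normed_vector \<Rightarrow> nat \<Rightarrow> real ^ 'd"
  assumes L: "\<And>p. (L has_derivative L' p) (at p)"
    and Y: "\<And>\<nu>. ((\<lambda>e. Y e \<nu>) has_derivative Y' \<nu>) (at e)"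
  shows "((\<lambda>e. discrete_lagrangian s c b d h L (Y e)) has_derivative
      (\<lambda>v. \<Sum>\<nu>=0..s. stage_differential s c b d h L' (Y e) \<nu> (Y' \<nu> v))) (at e)"
proof -
  let ?n = "\<lambda>i. node_state s d h (c i * h)"
  have lin: "linear (L' p)" for p
    by (rule bounded_linear.linear[OF has_derivative_bounded_linear[OF L]])
  have "((\<lambda>e. \<Sum>\<nu>=0..s. ?n i \<nu> (Y e \<nu>)) has_derivative (\<lambda>v. \<Sum>\<nu>=0..s. ?n i \<nu> (Y' \<nu> v))) (at e)" for i
    by (intro has_derivative_sum bounded_linear.has_derivative[OF bounded_linear_node_state] Y)
  from has_derivative_compose[OF this L]
  have "((\<lambda>e. discrete_lagrangian s c b d h L (Y e)) has_derivative
      (\<lambda>v. h * (\<Sum>i=0..s. b i * L' (\<Sum>\<nu>=0..s. ?n i \<nu> (Y e \<nu>)) (\<Sum>\<nu>=0..s. ?n i \<nu> (Y' \<nu> v))))) (at e)"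
    unfolding discrete_lagrangian_eq by (intro has_derivative_mult_right has_derivative_sum)
  moreover have "h * (\<Sum>i=0..s. b i * L' (\<Sum>\<nu>=0..s. ?n i \<nu> (Y e \<nu>)) (\<Sum>\<nu>=0..s. ?n i \<nu> (Y' \<nu> v))) =
      (\<Sum>\<nu>=0..s. stage_differential s c b d h L' (Y e) \<nu> (Y' \<nu> v))" for v
    unfolding stage_differential_def linear_sum[OF lin] sum_distrib_left by (rule sum.swap)
  ultimately show ?thesis by simp
qed

lemma bounded_linear_stage_differential:
  fixes L :: "(real ^ 'd) \<times> (real ^ 'd) \<Rightarrow> real"
  assumes L: "\<And>p. (L has_derivative L' p) (at p)"
  shows "bounded_linear (stage_differential s c b d h L' X \<nu>)"
  unfolding stage_differential_def[abs_def]
  by (intro bounded_linear_const_mult bounded_linear_sum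
      bounded_linear_compose[OF has_derivative_bounded_linear[OF L] bounded_linear_node_state])

lemma partial_grad_eqI:
  assumes "((\<lambda>v. F (X(i := v))) has_derivative (\<lambda>v. inner g v)) (at (X i))"
  shows "partial_grad F i X = g"
  unfolding partial_grad_def
proof (rule the_equality)
  show "GDERIV (\<lambda>v. F (X(i := v))) (X i) :> g"
    using assms by (simp add: gderiv_def inner_commute)
next
  fix g' assume "GDERIV (\<lambda>v. F (X(i := v))) (X i) :> g'"
  then have "(\<lambda>v. inner v g') = (\<lambda>v. inner g v)"
    unfolding gderiv_def using assms has_derivative_unique by blast
  then have "inner v g' = inner v g" for v by (metis inner_commute)
  then show "g' = g" using vector_eq_ldot by blast
qed

text \<open>
  The gradient in \<^const>\<open>partial_grad\<close> is a definite description; the chain rule along the curves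
  $v \mapsto X(i := v)$ shows that it exists and represents the stage differential.
\<close>
lemma partial_grad_discrete_lagrangian:
  fixes L :: "(real ^ 'd) \<times> (real ^ 'd) \<Rightarrow> real" and X :: "nat \<Rightarrow> real ^ 'd"
  assumes L: "\<And>p. (L has_derivative L' p) (at p)" and i: "i \<le> s"
  shows "stage_differential s c b d h L' X i v =
    inner (partial_grad (discrete_lagrangian s c b d h L) i X) v"
proof -
  let ?D = "stage_differential s c b d h L' X"
  obtain g where g: "\<And>v. ?D i v = inner g v"
    using bounded_linear_inner_representation[OF bounded_linear_stage_differential[OF L]] by metis
  have zero: "?D \<nu> 0 = 0" for \<nu>
    by (rule linear_0[OF bounded_linear.linear[OF bounded_linear_stage_differential[OF L]]])
  have "((\<lambda>v. (X(i := v)) \<nu>) has_derivative (\<lambda>v. if \<nu> = i then v else 0)) (at (X i))" for \<nu>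
    by (cases "\<nu> = i") auto
  from discrete_lagrangian_chain_rule[where L = L and Y = "\<lambda>v. X(i := v)", OF L this]
  have "((\<lambda>v. discrete_lagrangian s c b d h L (X(i := v))) has_derivative
      (\<lambda>v. \<Sum>\<nu>=0..s. ?D \<nu> (if \<nu> = i then v else 0))) (at (X i))"
    by simp
  moreover have "(\<Sum>\<nu>=0..s. ?D \<nu> (if \<nu> = i then v else 0)) = inner g v" for v
  proof -
    have "(\<Sum>\<nu>=0..s. ?D \<nu> (if \<nu> = i then v else 0)) = (\<Sum>\<nu>=0..s. if \<nu> = i then ?D i v else 0)"
      using zero by (intro sum.cong) auto
    then show ?thesis using i g by simp
  qed
  ultimately have "partial_grad (discrete_lagrangian s c b d h L) i X = g"
    by (intro partial_grad_eqI) simp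
  then show ?thesis using g by simp
qed

lemma discrete_lagrangian_variation:
  fixes L :: "(real ^ 'd) \<times> (real ^ 'd) \<Rightarrow> real" and X \<delta> :: "nat \<Rightarrow> real ^ 'd"
  assumes L: "\<And>p. (L has_derivative L' p) (at p)"
  shows "((\<lambda>\<epsilon>. discrete_lagrangian s c b d h L (\<lambda>i. X i + \<epsilon> *\<^sub>R \<delta> i)) has_real_derivative
    (\<Sum>i=0..s. inner (partial_grad (discrete_lagrangian s c b d h L) i X) (\<delta> i))) (at 0)"
proof -
  have "((\<lambda>\<epsilon>. X i + \<epsilon> *\<^sub>R \<delta> i) has_derivative (\<lambda>v. v *\<^sub>R \<delta> i)) (at 0)" for i
    by (auto intro!: derivative_eq_intros)
  from discrete_lagrangian_chain_rule[OF L this]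
  have "((\<lambda>\<epsilon>. discrete_lagrangian s c b d h L (\<lambda>i. X i + \<epsilon> *\<^sub>R \<delta> i)) has_derivative
    (\<lambda>v. \<Sum>i=0..s. stage_differential s c b d h L' X i (v *\<^sub>R \<delta> i))) (at 0)"
    by simp
  also have "(\<lambda>v. \<Sum>i=0..s. stage_differential s c b d h L' X i (v *\<^sub>R \<delta> i)) =
    (*) (\<Sum>i=0..s. inner (partial_grad (discrete_lagrangian s c b d h L) i X) (\<delta> i))"
    by (auto simp: fun_eq_iff sum_distrib_left partial_grad_discrete_lagrangian[OF L] mult.commute
        intro!: sum.cong)
  finally show ?thesis unfolding has_field_derivative_def .
qed

text \<open>
  The residuals at the last stage of step $k - 1$ and at the first stage of step $k$ meet the same
  variation $\delta_{k-1}^{s+1} = \delta_k^1$, so only their sum matters; at both ends of the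
  time interval the variation vanishes.
\<close>
lemma restricted_summation_by_parts:
  fixes e \<delta> :: "nat \<Rightarrow> nat \<Rightarrow> 'a::real_inner"
  assumes s: "s \<ge> 1" and \<delta>: "restricted_variation s N \<delta>"
    and inner_stages: "\<And>k i. k < N \<Longrightarrow> 1 \<le> i \<Longrightarrow> i < s \<Longrightarrow> e k i = 0"
    and joints: "\<And>k. 1 \<le> k \<Longrightarrow> k < N \<Longrightarrow> e (k - 1) s + e k 0 = 0"
  shows "(\<Sum>k<N. \<Sum>i=0..s. inner (e k i) (\<delta> k i)) = 0"
proof (cases N)
  case (Suc K)
  have d: "\<delta> k s = \<delta> (Suc k) 0" if "k < N" for k
    using \<delta> that unfolding restricted_variation_def by (auto dest: bspec[of _ _ "Suc k"])
  have d0: "\<delta> 0 0 = 0" and dN: "\<delta> N 0 = 0" using \<delta> unfolding restricted_variation_def by auto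
  have "(\<Sum>i=0..s. inner (e k i) (\<delta> k i)) = inner (e k 0) (\<delta> k 0) + inner (e k s) (\<delta> (Suc k) 0)"
    if "k < N" for k
  proof -
    have "(\<Sum>i=0..s. inner (e k i) (\<delta> k i)) = (\<Sum>i\<in>{0, s}. inner (e k i) (\<delta> k i))"
      using inner_stages[OF that] s
      by (intro sum.mono_neutral_right) (auto simp: Suc_le_eq)
    then show ?thesis using s d[OF that] by simp
  qed
  then have "(\<Sum>k<N. \<Sum>i=0..s. inner (e k i) (\<delta> k i)) =
      (\<Sum>k<N. inner (e k 0) (\<delta> k 0)) + (\<Sum>k<N. inner (e k s) (\<delta> (Suc k) 0))"
    by (simp add: sum.distrib)
  also have "(\<Sum>k<N. inner (e k 0) (\<delta> k 0)) = (\<Sum>k<K. inner (e (Suc k) 0) (\<delta> (Suc k) 0))"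
    unfolding Suc sum.lessThan_Suc_shift using d0 by simp
  also have "(\<Sum>k<N. inner (e k s) (\<delta> (Suc k) 0)) = (\<Sum>k<K. inner (e k s) (\<delta> (Suc k) 0))"
    using dN unfolding Suc by simp
  also have "(\<Sum>k<K. inner (e (Suc k) 0) (\<delta> (Suc k) 0)) + (\<Sum>k<K. inner (e k s) (\<delta> (Suc k) 0)) =
      (\<Sum>k<K. inner (e k s + e (Suc k) 0) (\<delta> (Suc k) 0))"
    by (simp add: inner_add_left sum.distrib)
  also have "\<dots> = 0"
    using joints[of "Suc k" for k] Suc by (intro sum.neutral) auto
  finally show ?thesis .
qed simp


section \<open>Extremals under restricted variations\<close>

theorem theorem4p2:
  fixes s N :: nat
    and \<rho> \<alpha> h :: real
    and L :: "(real ^ 'd) \<times> (real ^ 'd) \<Rightarrow> real"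
    and b c d :: "nat \<Rightarrow> real"
    and A :: "real mat"
    and W :: "real \<Rightarrow> nat \<Rightarrow> real mat"
    and x y :: "nat \<Rightarrow> nat \<Rightarrow> real ^ 'd"
    and Ld :: "(nat \<Rightarrow> real ^ 'd) \<Rightarrow> real"
  assumes "Ld = discrete_lagrangian s c b d h L"
    and "s \<ge> 1" and "\<rho> > 0" and "\<alpha> > 0" and "h > 0"
    and "C2 L"
    and "lobatto_IIIC s c b A"
    and "strict_mono_on {0..s} d" and "d 0 = 0" and "d s = 1"
    and "\<And>\<beta>. \<beta> > 0 \<Longrightarrow> cq_weights s A b h \<beta> (W \<beta>)"
    and "\<And>k. 1 \<le> k \<Longrightarrow> k \<le> N \<Longrightarrow> x (k - 1) s = x k 0"
    and "\<And>k. 1 \<le> k \<Longrightarrow> k \<le> N \<Longrightarrow> y (k - 1) s = y k 0"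
    and "\<And>i. 1 \<le> i \<Longrightarrow> i \<le> s \<Longrightarrow> x N i = 0"
    and "\<And>i. 1 \<le> i \<Longrightarrow> i \<le> s \<Longrightarrow> y N i = 0"
    and "\<And>k. 1 \<le> k \<Longrightarrow> k < N \<Longrightarrow>
      partial_grad Ld s (x (k - 1)) + partial_grad Ld 0 (x k)
      - (\<rho> * h) *\<^sub>R (b 0 *\<^sub>R cq_minus s (W (2 * \<alpha>)) x k 0
                    + b s *\<^sub>R cq_minus s (W (2 * \<alpha>)) x (k - 1) s) = 0"
    and "\<And>k i. k < N \<Longrightarrow> 1 \<le> i \<Longrightarrow> i < s \<Longrightarrow>
      partial_grad Ld i (x k) - (\<rho> * h * b i) *\<^sub>R cq_minus s (W (2 * \<alpha>)) x k i = 0"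
    and "\<And>k. 1 \<le> k \<Longrightarrow> k < N \<Longrightarrow>
      partial_grad Ld s (y (k - 1)) + partial_grad Ld 0 (y k)
      - (\<rho> * h) *\<^sub>R (cq_plus s N (W (2 * \<alpha>)) (weighted b y) k 0
                    + cq_plus s N (W (2 * \<alpha>)) (weighted b y) (k - 1) s) = 0"
    and "\<And>k i. k < N \<Longrightarrow> 1 \<le> i \<Longrightarrow> i < s \<Longrightarrow>
      partial_grad Ld i (y k) - (\<rho> * h) *\<^sub>R cq_plus s N (W (2 * \<alpha>)) (weighted b y) k i = 0"
  shows "restricted_extremal s N (discrete_action s N b h \<rho> (W \<alpha>) Ld) x y"
proof -
  have Ld: "Ld = discrete_lagrangian s c b d h L"
    and s: "s \<ge> 1" and \<alpha>: "\<alpha> > 0"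
    and IIIC: "lobatto_IIIC s c b A"
    and cq: "\<And>\<beta>. \<beta> > 0 \<Longrightarrow> cq_weights s A b h \<beta> (W \<beta>)"
    by fact+
  obtain L' where L: "\<And>p. (L has_derivative blinfun_apply (L' p)) (at p)"
    using \<open>C2 L\<close> unfolding C2_def by blast
  have carrier: "W \<beta> n \<in> carrier_mat (s + 1) (s + 1)" if "\<beta> > 0" for \<beta> n
    using cq[OF that] unfolding cq_weights_def by blast
  have double: "cq_weights s A b h (\<alpha> + \<alpha>) (W (2 * \<alpha>))"
    using cq[of "2 * \<alpha>"] \<alpha> by (simp only: mult_2[symmetric])
  have semigroup: "cq_minus s (W \<alpha>) (cq_minus s (W \<alpha>) f) k i = cq_minus s (W (2 * \<alpha>)) f k i"
    if "i \<le> s" for f :: "nat \<Rightarrow> nat \<Rightarrow> real ^ 'd" and k i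
  proof (rule cq_minus_cq_minus[OF _ that])
    fix n i j assume "i \<le> s" "j \<le> s"
    then show "W (2 * \<alpha>) n $$ (i, j) = (\<Sum>m=0..n. \<Sum>q=0..s. W \<alpha> m $$ (i, q) * W \<alpha> (n - m) $$ (q, j))"
      by (rule cq_weights_convolution[OF rk_symbol_carrier[OF s IIIC] cq[OF \<alpha>] cq[OF \<alpha>] double])
  qed
  \<comment> \<open>the asymmetric pairing of the action is expressed by the one-sided operator of order $2 \alpha$\<close>
  have pairing: "(\<Sum>k=0..N. \<Sum>i=0..s. inner (cq_plus s N (W \<alpha>) (weighted b g) k i) (cq_minus s (W \<alpha>) f k i)) =
      (\<Sum>k=0..N. \<Sum>i=0..s. inner (weighted b g k i) (cq_minus s (W (2 * \<alpha>)) f k i))"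
    for f g :: "nat \<Rightarrow> nat \<Rightarrow> real ^ 'd"
    unfolding cq_plus_adjoint[OF carrier[OF \<alpha>]]
    by (intro sum.cong refl arg_cong2[where f = inner] semigroup) auto
  show ?thesis
    unfolding restricted_extremal_def
  proof (intro allI impI)
    fix \<delta> :: "nat \<Rightarrow> nat \<Rightarrow> real ^ 'd"
    assume \<delta>: "restricted_variation s N \<delta>"
    let ?D = "cq_minus s (W (2 * \<alpha>))"
    let ?B = "\<lambda>g f. \<Sum>k=0..N. \<Sum>i=0..s. inner (weighted b g k i) (?D f k i)"
    let ?x = "\<lambda>\<epsilon> k i. x k i + \<epsilon> *\<^sub>R \<delta> k i" and ?y = "\<lambda>\<epsilon> k i. y k i + \<epsilon> *\<^sub>R \<delta> k i"
    let ?g = "\<lambda>z k i. inner (partial_grad Ld i (z k)) (\<delta> k i)"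
    have dN: "\<delta> N i = 0" if "i \<le> s" for i
      using \<delta> that unfolding restricted_variation_def by auto
    \<comment> \<open>as the same variation acts on both series, the linear term contains both one-sided pairings\<close>
    have expand: "?B (?y \<epsilon>) (?x \<epsilon>) = ?B y x + \<epsilon> * (?B \<delta> x + ?B y \<delta>) + \<epsilon>\<^sup>2 * ?B \<delta> \<delta>" for \<epsilon>
      unfolding cq_minus_linear weighted_def
      by (simp add: inner_add_left inner_add_right sum.distrib sum_distrib_left algebra_simps
          power2_eq_square)
    have Bx: "?B \<delta> x = (\<Sum>k<N. \<Sum>i=0..s. b i * inner (?D x k i) (\<delta> k i))"
    proof -
      have "?B \<delta> x = (\<Sum>k=0..N. \<Sum>i=0..s. b i * inner (?D x k i) (\<delta> k i))"
        unfolding weighted_def by (simp add: inner_commute)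
      also have "\<dots> = (\<Sum>k<N. \<Sum>i=0..s. b i * inner (?D x k i) (\<delta> k i))"
        using dN by (simp add: atLeast0AtMost flip: lessThan_Suc_atMost)
      finally show ?thesis .
    qed
    have By: "?B y \<delta> = (\<Sum>k<N. \<Sum>i=0..s. inner (cq_plus s N (W (2 * \<alpha>)) (weighted b y) k i) (\<delta> k i))"
    proof -
      have "?B y \<delta> = (\<Sum>k=0..N. \<Sum>i=0..s. inner (cq_plus s N (W (2 * \<alpha>)) (weighted b y) k i) (\<delta> k i))"
        using \<alpha> by (intro cq_plus_adjoint[symmetric] carrier) auto
      also have "\<dots> = (\<Sum>k<N. \<Sum>i=0..s. inner (cq_plus s N (W (2 * \<alpha>)) (weighted b y) k i) (\<delta> k i))"
        using dN by (simp add: atLeast0AtMost flip: lessThan_Suc_atMost)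
      finally show ?thesis .
    qed
    have "((\<lambda>\<epsilon>. discrete_action s N b h \<rho> (W \<alpha>) Ld (?x \<epsilon>) (?y \<epsilon>)) has_real_derivative
        (\<Sum>k<N. (\<Sum>i=0..s. ?g x k i) + (\<Sum>i=0..s. ?g y k i)) - \<rho> * h * (?B \<delta> x + ?B y \<delta>)) (at 0)"
    proof -
      have "((\<lambda>\<epsilon>. \<Sum>k<N. Ld (?x \<epsilon> k) + Ld (?y \<epsilon> k)) has_real_derivative
          (\<Sum>k<N. (\<Sum>i=0..s. ?g x k i) + (\<Sum>i=0..s. ?g y k i))) (at 0)"
        unfolding Ld by (intro DERIV_sum DERIV_add discrete_lagrangian_variation[OF L])
      moreover have "((\<lambda>\<epsilon>. \<rho> * h * ?B (?y \<epsilon>) (?x \<epsilon>)) has_real_derivative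
          \<rho> * h * (?B \<delta> x + ?B y \<delta>)) (at 0)"
        unfolding expand by (rule DERIV_cong) (auto intro!: derivative_eq_intros)
      ultimately show ?thesis
        unfolding discrete_action_def pairing by (rule DERIV_diff)
    qed
    moreover have "(\<Sum>k<N. \<Sum>i=0..s. inner (partial_grad Ld i (x k) - (\<rho> * h * b i) *\<^sub>R ?D x k i) (\<delta> k i)) = 0"
    proof (rule restricted_summation_by_parts[OF s \<delta>])
      fix k assume "1 \<le> k" "k < N"
      then show "partial_grad Ld s (x (k - 1)) - (\<rho> * h * b s) *\<^sub>R ?D x (k - 1) s +
          (partial_grad Ld 0 (x k) - (\<rho> * h * b 0) *\<^sub>R ?D x k 0) = 0"
        using assms(16)[of k] by (simp add: algebra_simps)
    qed (use assms(17) in auto)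
    moreover have "(\<Sum>k<N. \<Sum>i=0..s. inner (partial_grad Ld i (y k) -
        (\<rho> * h) *\<^sub>R cq_plus s N (W (2 * \<alpha>)) (weighted b y) k i) (\<delta> k i)) = 0"
    proof (rule restricted_summation_by_parts[OF s \<delta>])
      fix k assume "1 \<le> k" "k < N"
      then show "partial_grad Ld s (y (k - 1)) - (\<rho> * h) *\<^sub>R cq_plus s N (W (2 * \<alpha>)) (weighted b y) (k - 1) s +
          (partial_grad Ld 0 (y k) - (\<rho> * h) *\<^sub>R cq_plus s N (W (2 * \<alpha>)) (weighted b y) k 0) = 0"
        using assms(18)[of k] by (simp add: algebra_simps)
    qed (use assms(19) in auto)
    ultimately show "((\<lambda>\<epsilon>. discrete_action s N b h \<rho> (W \<alpha>) Ld (?x \<epsilon>) (?y \<epsilon>)) has_real_derivative 0) (at 0)"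
      unfolding Bx By
      by (simp add: inner_diff_left sum_subtractf sum.distrib sum_distrib_left algebra_simps)
  qed
qed

end
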